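(* Let $\Omega\subset\mathbb{R}^d$ be open, let $Y$ be a Banach space of continuous maps from $\Omega$ to $\mathbb{C}^d$ whose norm dominates the $C^{0,1}(\Omega)$ norm, let $\delta>0$, and let $B_\delta=\{X:\Omega\to\mathbb{C}^d : X-\mathrm{Id}\in Y,\ \|X-\mathrm{Id}\|_Y\le\delta\}$. Suppose that $\tilde F:B_\delta\to Y$ satisfies a bound $$\sup_{X\in B_\delta}\|\tilde F(X)\|_Y\le C<\infty$$ and that $\tilde F$ preserves analyticity. Let $\epsilon=\delta/10$. Then for all sufficiently small $r_1>0$ the map $$\Phi_{\tilde F}(X_{(\cdot)})(t)=\mathrm{Id}+\int_0^t\tilde F(X_\zeta)\,d\zeta,\qquad t\in d_{r_1},$$ (integration along the straight path from $0$ to $t$) maps $\mathcal{B}_{\epsilon,r_1}$ to itself and has a unique fixed point $X_{(\cdot)}\in\mathcal{B}_{\epsilon,r_1}$; moreover the function $X(\alpha,t)=X_t(\alpha)$ is analytic in $t$ on $d_{r_1}$ and is the unique solution (in $\mathcal{B}_{\epsilon,r_1}$) of $$\frac{d}{dt}X_t=\tilde F(X_t),\qquad X_t|_{t=0}=\mathrm{Id}.$$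
   Context: $\mathrm{Id}$ is the identity map. That the norm of $Y$ dominates the $C^{0,1}$ norm means there is a constant $C'$ with $\|f\|_{C^{0,1}(\Omega)}=\sup_{x\in\Omega}|f(x)|+\sup_{x\ne y\in\Omega}\frac{|f(x)-f(y)|}{|x-y|}\le C'\|f\|_Y$ for all $f\in Y$. For $r>0$, $d_r=\{z\in\mathbb{C}:|z|<r\}$. $\mathcal{Y}_r$ is the set of maps $z\mapsto X_z$ from $d_r$ to $Y$ that are analytic as $Y$-valued functions. For $\eta>0$, $B_\eta=\{X:\|X-\mathrm{Id}\|_Y\le\eta\}$ and $\mathcal{B}_{\eta,r}$ is the set of maps $X_{(\cdot)}$ on $d_r$ with $(X_{(\cdot)}-\mathrm{Id})\in\mathcal{Y}_r$ and $X_z\in B_\eta$ for all $z\in d_r$. "$\tilde F$ preserves analyticity" means: for every $r>0$, every $X_{(\cdot)}\in\mathcal{B}_{\delta,r}$, and every fixed $\alpha\in\Omega$, the function $z\mapsto\tilde F(X_z)(\alpha)\in\mathbb{C}^d$ is analytic in $d_r$. *)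

theory Defs
  imports "HOL-Complex_Analysis.Complex_Analysis"
begin

text \<open>
  A map from \<open>\<Omega>\<close> to \<open>\<complex>\<^sup>d\<close> is represented by the total function that agrees with it on \<open>\<Omega>\<close> and
  is \<open>0\<close> off \<open>\<Omega>\<close>, so that equality of maps on \<open>\<Omega>\<close> is equality in HOL.  A Banach space of
  such maps is a carrier \<open>Y\<close> together with its norm \<open>N\<close>; the values of \<open>N\<close> outside \<open>Y\<close> are
  irrelevant.  The scalars are complex, since \<open>Y\<close>-valued analytic functions are considered.
\<close>

locale banach_map_space =
  fixes \<Omega> :: "(real ^ 'd) set"
    and Y :: "(real ^ 'd \<Rightarrow> complex ^ 'd) set"
    and N :: "(real ^ 'd \<Rightarrow> complex ^ 'd) \<Rightarrow> real"
  assumes continuous: "f \<in> Y \<Longrightarrow> continuous_on \<Omega> f"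
    and zero_outside: "f \<in> Y \<Longrightarrow> x \<notin> \<Omega> \<Longrightarrow> f x = 0"
    and zero_mem: "(\<lambda>x. 0) \<in> Y"
    and add_mem: "f \<in> Y \<Longrightarrow> g \<in> Y \<Longrightarrow> (\<lambda>x. f x + g x) \<in> Y"
    and scale_mem: "f \<in> Y \<Longrightarrow> (\<lambda>x. c *s f x) \<in> Y"
    and norm_nonneg: "f \<in> Y \<Longrightarrow> 0 \<le> N f"
    and norm_eq_0: "f \<in> Y \<Longrightarrow> N f = 0 \<longleftrightarrow> f = (\<lambda>x. 0)"
    and norm_triangle: "f \<in> Y \<Longrightarrow> g \<in> Y \<Longrightarrow> N (\<lambda>x. f x + g x) \<le> N f + N g"
    and norm_scale: "f \<in> Y \<Longrightarrow> N (\<lambda>x. c *s f x) = cmod c * N f"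
    and complete:
      "(\<And>n. u n \<in> Y) \<Longrightarrow>
       (\<And>e. 0 < e \<Longrightarrow> \<exists>M. \<forall>m\<ge>M. \<forall>n\<ge>M. N (\<lambda>x. u m x - u n x) < e) \<Longrightarrow>
       \<exists>l\<in>Y. (\<lambda>n::nat. N (\<lambda>x. u n x - l x)) \<longlonglongrightarrow> 0"

text \<open>
  The \<open>C\<^sup>0\<^sup>,\<^sup>1\<close> norm takes values in \<^typ>\<open>ennreal\<close>, because a real-valued supremum over an unbounded
  set would be a meaningless number.
\<close>

definition C01_norm :: "(real ^ 'd) set \<Rightarrow> (real ^ 'd \<Rightarrow> complex ^ 'd) \<Rightarrow> ennreal" where
  "C01_norm \<Omega> f =
     (SUP x\<in>\<Omega>. ennreal (norm (f x))) +
     (SUP (x, y)\<in>{(x, y). x \<in> \<Omega> \<and> y \<in> \<Omega> \<and> x \<noteq> y}. ennreal (norm (f x - f y) / norm (x - y)))"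

definition dominates_C01 ::
    "(real ^ 'd) set \<Rightarrow> (real ^ 'd \<Rightarrow> complex ^ 'd) set
     \<Rightarrow> ((real ^ 'd \<Rightarrow> complex ^ 'd) \<Rightarrow> real) \<Rightarrow> bool" where
  "dominates_C01 \<Omega> Y N \<longleftrightarrow> (\<exists>C'::real. \<forall>f\<in>Y. C01_norm \<Omega> f \<le> ennreal (C' * N f))"

definition Id_map :: "(real ^ 'd) set \<Rightarrow> real ^ 'd \<Rightarrow> complex ^ 'd" where
  "Id_map \<Omega> x = (if x \<in> \<Omega> then (\<chi> i. complex_of_real (x $ i)) else 0)"

definition vec_analytic_on :: "(complex \<Rightarrow> complex ^ 'd) \<Rightarrow> complex set \<Rightarrow> bool"
    (infixl "vec'_analytic'_on" 50) where
  "f vec_analytic_on S \<longleftrightarrow> (\<forall>i. (\<lambda>z. f z $ i) analytic_on S)"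

text \<open>\<open>D\<close> is the complex derivative of \<open>f\<close> at \<open>z\<close>, the limit being taken in the norm \<open>N\<close>.\<close>

definition has_norm_derivative ::
    "((real ^ 'd \<Rightarrow> complex ^ 'd) \<Rightarrow> real) \<Rightarrow> (complex \<Rightarrow> real ^ 'd \<Rightarrow> complex ^ 'd)
     \<Rightarrow> (real ^ 'd \<Rightarrow> complex ^ 'd) \<Rightarrow> complex \<Rightarrow> bool" where
  "has_norm_derivative N f D z \<longleftrightarrow>
     ((\<lambda>w. N (\<lambda>x. (1 / (w - z)) *s (f w x - f z x) - D x)) \<longlongrightarrow> 0) (at z)"

text \<open>
  The disc \<open>d\<^sub>r\<close> is \<^term>\<open>ball (0::complex) r\<close>.  A map on \<open>d\<^sub>r\<close> is represented by a total function
  whose values outside \<open>d\<^sub>r\<close> play no role.  As for \<^const>\<open>analytic_on\<close> in the library, analyticity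
  on the open disc means complex differentiability at each of its points.
\<close>

definition analytic_maps ::
    "(real ^ 'd \<Rightarrow> complex ^ 'd) set \<Rightarrow> ((real ^ 'd \<Rightarrow> complex ^ 'd) \<Rightarrow> real) \<Rightarrow> real
     \<Rightarrow> (complex \<Rightarrow> real ^ 'd \<Rightarrow> complex ^ 'd) set" where
  "analytic_maps Y N r =
     {f. \<forall>z\<in>ball 0 r. f z \<in> Y \<and> (\<exists>D\<in>Y. has_norm_derivative N f D z)}"

definition Id_ball ::
    "(real ^ 'd) set \<Rightarrow> (real ^ 'd \<Rightarrow> complex ^ 'd) set \<Rightarrow> ((real ^ 'd \<Rightarrow> complex ^ 'd) \<Rightarrow> real)
     \<Rightarrow> real \<Rightarrow> (real ^ 'd \<Rightarrow> complex ^ 'd) set" where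
  "Id_ball \<Omega> Y N \<eta> =
     {X. (\<lambda>x. X x - Id_map \<Omega> x) \<in> Y \<and> N (\<lambda>x. X x - Id_map \<Omega> x) \<le> \<eta>}"

definition analytic_Id_ball ::
    "(real ^ 'd) set \<Rightarrow> (real ^ 'd \<Rightarrow> complex ^ 'd) set \<Rightarrow> ((real ^ 'd \<Rightarrow> complex ^ 'd) \<Rightarrow> real)
     \<Rightarrow> real \<Rightarrow> real \<Rightarrow> (complex \<Rightarrow> real ^ 'd \<Rightarrow> complex ^ 'd) set" where
  "analytic_Id_ball \<Omega> Y N \<eta> r =
     {X. (\<lambda>z x. X z x - Id_map \<Omega> x) \<in> analytic_maps Y N r \<and>
         (\<forall>z\<in>ball 0 r. X z \<in> Id_ball \<Omega> Y N \<eta>)}"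

definition preserves_analyticity ::
    "(real ^ 'd) set \<Rightarrow> (real ^ 'd \<Rightarrow> complex ^ 'd) set \<Rightarrow> ((real ^ 'd \<Rightarrow> complex ^ 'd) \<Rightarrow> real)
     \<Rightarrow> real \<Rightarrow> ((real ^ 'd \<Rightarrow> complex ^ 'd) \<Rightarrow> (real ^ 'd \<Rightarrow> complex ^ 'd)) \<Rightarrow> bool" where
  "preserves_analyticity \<Omega> Y N \<delta> F \<longleftrightarrow>
     (\<forall>r>0. \<forall>X\<in>analytic_Id_ball \<Omega> Y N \<delta> r. \<forall>\<alpha>\<in>\<Omega>. (\<lambda>z. F (X z) \<alpha>) vec_analytic_on ball 0 r)"

text \<open>
  The integral of the map-valued function \<open>\<zeta> \<mapsto> F (X \<zeta>)\<close> is taken at each point and in each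
  component.  This is the \<open>Y\<close>-valued integral whenever the latter exists, because evaluation at a
  point is continuous on \<open>Y\<close> when the norm dominates the \<open>C\<^sup>0\<^sup>,\<^sup>1\<close> norm; that the result is an
  element of \<open>Y\<close> is not built in.
\<close>

definition Phi ::
    "(real ^ 'd) set \<Rightarrow> ((real ^ 'd \<Rightarrow> complex ^ 'd) \<Rightarrow> (real ^ 'd \<Rightarrow> complex ^ 'd))
     \<Rightarrow> (complex \<Rightarrow> real ^ 'd \<Rightarrow> complex ^ 'd) \<Rightarrow> complex \<Rightarrow> real ^ 'd \<Rightarrow> complex ^ 'd" where
  "Phi \<Omega> F X t = (\<lambda>\<alpha>. Id_map \<Omega> \<alpha> +
     (\<chi> i. contour_integral (linepath 0 t) (\<lambda>\<zeta>. F (X \<zeta>) \<alpha> $ i)))"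

definition solves_ode ::
    "(real ^ 'd) set \<Rightarrow> ((real ^ 'd \<Rightarrow> complex ^ 'd) \<Rightarrow> real)
     \<Rightarrow> ((real ^ 'd \<Rightarrow> complex ^ 'd) \<Rightarrow> (real ^ 'd \<Rightarrow> complex ^ 'd)) \<Rightarrow> real
     \<Rightarrow> (complex \<Rightarrow> real ^ 'd \<Rightarrow> complex ^ 'd) \<Rightarrow> bool" where
  "solves_ode \<Omega> N F r X \<longleftrightarrow>
     (\<forall>t\<in>ball 0 r. has_norm_derivative N X (F (X t)) t) \<and> X 0 = Id_map \<Omega>"

end

theory Submission
  imports Defs
begin

text \<open>
  The crux is that a bounded \<open>Y\<close>-valued function on a disc whose point values are holomorphic is
  already analytic in the norm of \<open>Y\<close>, although its Cauchy integrals are not known to exist in \<open>Y\<close>.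
  A functional \<open>h \<mapsto> \<Sum>n. \<kappa> n * a n\<close> of the Taylor coefficients \<open>a n\<close> of \<open>h\<close> is written as an
  absolutely convergent series of point evaluations: a discrete Fourier sum over \<open>m\<close> points of a
  circle reproduces the first \<open>m\<close> coefficients, and for large \<open>m\<close> the error is a functional of at most
  half the size on a slightly larger circle, to which the same is applied. Evaluating the series
  on the \<open>Y\<close>-valued function gives an element of \<open>Y\<close> by completeness; this produces derivatives and
  primitives in \<open>Y\<close>, with bounds.

  Applied along the complex lines \<open>X + z (X' - X)\<close>, which stay in the ball of radius \<open>\<delta>\<close> for \<open>z\<close> in a
  disc of radius \<open>9\<epsilon> / \<parallel>X' - X\<parallel>\<close>, the bound on the derivative makes \<open>F\<close> Lipschitz on the ball of
  radius \<open>\<epsilon>\<close>. Hence \<open>\<Phi>\<close> is a contraction on small discs, and its Picard iterates converge.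
\<close>

no_notation fps_nth (infixl \<open>$\<close> 75)

section \<open>Taylor functionals as series of point evaluations\<close>

text \<open>Orthogonality of the characters of a cyclic group of order \<open>m\<close>. The ratio
  is an \<open>m\<close>-th root of unity, equal to 1 exactly when \<open>n\<close> is the residue
  of \<open>l\<close>; otherwise its geometric sum vanishes.\<close>

lemma sum_roots_of_unity_kernel:
  fixes l n m :: nat
  assumes "n < m"
  defines "\<omega> \<equiv> cis (2 * pi / real m)"
  shows "(\<Sum>j<m. (\<omega> ^ l / \<omega> ^ n) ^ j) = (if n = l mod m then of_nat m else 0)"
proof -
  have m: "0 < m" using assms by simp
  have pow: "\<omega> ^ k = cis (2 * pi * real k / real m)" for k
    unfolding \<omega>_def Complex.DeMoivre by (simp add: mult_ac)
  have om: "\<omega> ^ m = 1" using m by (simp add: pow)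
  have red: "\<omega> ^ l = \<omega> ^ (l mod m)"
  proof -
    have "\<omega> ^ l = \<omega> ^ (m * (l div m) + l mod m)" by simp
    also have "\<dots> = \<omega> ^ (l mod m)" unfolding power_add power_mult om by simp
    finally show ?thesis .
  qed
  have nz: "\<omega> \<noteq> 0" by (simp add: \<omega>_def)
  show ?thesis
  proof (cases "n = l mod m")
    case True
    then show ?thesis using red nz by simp
  next
    case False
    have "\<omega> ^ (l mod m) \<noteq> \<omega> ^ n"
      using bij_betw_imp_inj_on[OF Complex.bij_betw_roots_unity[OF m]] False assms(1) m
      unfolding pow inj_on_def by (metis lessThan_iff mod_less_divisor)
    then have "\<omega> ^ l / \<omega> ^ n \<noteq> 1" using red nz by simp
    moreover have "(\<omega> ^ l / \<omega> ^ n) ^ m = 1"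
      by (metis om div_by_1 mult.commute power_divide power_mult power_one)
    moreover have "(\<Sum>j<m. q ^ j) = 0" if "q \<noteq> 1" "q ^ m = 1" for q :: complex
      using that by (simp add: sum_gp_strict)
    ultimately have "(\<Sum>j<m. (\<omega> ^ l / \<omega> ^ n) ^ j) = 0" by blast
    then show ?thesis using False by (simp only: if_False)
  qed
qed

text \<open>
  The weights \<open>c\<close> are the discrete Fourier transform of \<open>\<kappa>\<close> truncated to indices below \<open>m\<close>; by aliasing,
  the remainder \<open>\<kappa>'\<close> vanishes there.
\<close>

lemma quadrature_step:
  fixes \<kappa> :: "nat \<Rightarrow> complex" and \<rho> \<sigma> S :: real
  assumes "0 < \<rho>" "\<rho> < \<sigma>" "0 < S"
    and summ: "summable (\<lambda>n. norm (\<kappa> n) / \<rho> ^ n)" and le: "(\<Sum>n. norm (\<kappa> n) / \<rho> ^ n) \<le> S"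
  obtains w c :: "nat \<Rightarrow> complex" and m :: nat and \<kappa>' :: "nat \<Rightarrow> complex"
  where "\<And>j. norm (w j) = \<rho>" "(\<Sum>j<m. norm (c j)) \<le> S"
    and "\<And>l. \<kappa> l = (\<Sum>j<m. c j * w j ^ l) + \<kappa>' l"
    and "summable (\<lambda>n. norm (\<kappa>' n) / \<sigma> ^ n)" "(\<Sum>n. norm (\<kappa>' n) / \<sigma> ^ n) \<le> S / 2"
proof -
  define b where "b n = norm (\<kappa> n) / \<rho> ^ n" for n
  define q where "q = \<rho> / \<sigma>"
  have \<sigma>: "0 < \<sigma>" using assms by simp
  have q: "0 < q" "q < 1" using assms \<sigma> by (auto simp: q_def)
  have b0: "0 \<le> b n" for n using assms by (simp add: b_def)
  have bS: "b n \<le> S" for n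
    using sum_le_suminf[OF summ, of "{n}"] le b0 unfolding b_def by force
  \<comment> \<open>\<open>d\<close> will dominate the remainder on the larger circle:
    \<open>b n\<close> accounts for \<open>\<kappa>\<close> itself, and \<open>S * q ^ n\<close> for
    the aliased coefficient, which is at most \<open>S * \<rho> ^ n\<close>. As
    \<open>q < 1\<close>, \<open>d\<close> is summable, and \<open>m\<close> is taken so large that
    its tail is below \<open>S / 2\<close>.\<close>
  define d where "d n = b n + S * q ^ n" for n
  have sumd: "summable d" unfolding d_def b_def
    using q by (intro summable_add summ summable_mult summable_geometric) auto
  have d0: "0 \<le> d n" for n using b0 q \<open>0 < S\<close> by (simp add: d_def)
  have "eventually (\<lambda>m. (\<Sum>n. d (n + m)) < S / 2) sequentially"
    using suminf_exist_split2[OF sumd] \<open>0 < S\<close> by (intro order_tendstoD) auto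
  then obtain M where M: "\<And>m. m \<ge> M \<Longrightarrow> (\<Sum>n. d (n + m)) < S / 2"
    by (auto simp: eventually_sequentially)
  define m where "m = Suc M"
  have m: "0 < m" and tail: "(\<Sum>n. d (n + m)) < S / 2" using M[of m] by (auto simp: m_def)
  define \<omega> where "\<omega> = cis (2 * pi / real m)"
  define c where "c j = (\<Sum>n<m. \<kappa> n / of_real \<rho> ^ n / \<omega> ^ (j * n)) / of_nat m" for j
  define w where "w j = of_real \<rho> * \<omega> ^ j" for j
  define \<kappa>' where "\<kappa>' l = \<kappa> l - (\<Sum>j<m. c j * w j ^ l)" for l
  have nw: "norm \<omega> = 1" by (simp add: \<omega>_def)
  have nc: "(\<Sum>j<m. norm (c j)) \<le> S"
  proof -
    have "norm (c j) \<le> S / m" for j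
    proof -
      have "norm (\<Sum>n<m. \<kappa> n / of_real \<rho> ^ n / \<omega> ^ (j * n)) \<le> (\<Sum>n<m. b n)"
        by (rule sum_norm_le) (use assms(1) in \<open>simp add: b_def norm_divide norm_mult norm_power nw\<close>)
      also have "\<dots> \<le> S"
        using sum_le_suminf[OF summ, of "{..<m}"] le b0 unfolding b_def by force
      finally show ?thesis by (simp add: c_def norm_divide divide_right_mono)
    qed
    then have "(\<Sum>j<m. norm (c j)) \<le> (\<Sum>j<m. S / m)" by (intro sum_mono)
    then show ?thesis using m by simp
  qed
  \<comment> \<open>Exchanging the sums leaves only the index congruent to \<open>l\<close>, so the
    quadrature returns \<open>\<kappa>\<close> at the residue of \<open>l\<close>, rescaled by
    powers of \<open>\<rho>\<close>. For \<open>l < m\<close> this is \<open>\<kappa> l\<close>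
    itself, and the remainder begins at index \<open>m\<close>.\<close>
  have aliasing: "(\<Sum>j<m. c j * w j ^ l) = of_real \<rho> ^ l * (\<kappa> (l mod m) / of_real \<rho> ^ (l mod m))" for l
  proof -
    have "(\<Sum>j<m. c j * w j ^ l)
        = (\<Sum>j<m. \<Sum>n<m. of_real \<rho> ^ l * (\<kappa> n / of_real \<rho> ^ n) / of_nat m * (\<omega> ^ l / \<omega> ^ n) ^ j)"
      unfolding c_def w_def sum_divide_distrib sum_distrib_right
      by (intro sum.cong refl) (simp add: power_mult_distrib power_divide ac_simps flip: power_mult)
    also have "\<dots> = (\<Sum>n<m. of_real \<rho> ^ l * (\<kappa> n / of_real \<rho> ^ n) / of_nat m * (\<Sum>j<m. (\<omega> ^ l / \<omega> ^ n) ^ j))"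
      by (subst sum.swap) (simp add: sum_distrib_left)
    also have "\<dots> = (\<Sum>n<m. if n = l mod m then of_real \<rho> ^ l * (\<kappa> n / of_real \<rho> ^ n) else 0)"
      by (intro sum.cong refl) (use m in \<open>auto simp: sum_roots_of_unity_kernel \<omega>_def\<close>)
    also have "\<dots> = of_real \<rho> ^ l * (\<kappa> (l mod m) / of_real \<rho> ^ (l mod m))"
      using m by simp
    finally show ?thesis .
  qed
  have low: "\<kappa>' l = 0" if "l < m" for l
    unfolding \<kappa>'_def aliasing using that assms(1) by simp
  have high: "norm (\<kappa>' l) / \<sigma> ^ l \<le> d l" for l
  proof -
    have "norm (\<kappa>' l) \<le> norm (\<kappa> l) + \<rho> ^ l * b (l mod m)"
      unfolding \<kappa>'_def aliasing b_def
      by (rule order_trans[OF norm_triangle_ineq4]) (use assms(1) in \<open>simp add: norm_mult norm_divide norm_power\<close>)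
    also have "\<dots> \<le> norm (\<kappa> l) + \<rho> ^ l * S"
      using bS[of "l mod m"] assms(1) by (intro add_left_mono mult_left_mono) auto
    finally have "norm (\<kappa>' l) / \<sigma> ^ l \<le> (norm (\<kappa> l) + \<rho> ^ l * S) / \<sigma> ^ l"
      using \<sigma> by (simp add: divide_right_mono)
    also have "\<dots> = norm (\<kappa> l) / \<sigma> ^ l + S * q ^ l"
      by (simp add: q_def add_divide_distrib power_divide mult.commute)
    also have "norm (\<kappa> l) / \<sigma> ^ l \<le> b l"
      unfolding b_def using assms by (intro divide_left_mono power_mono mult_pos_pos) auto
    finally show ?thesis by (simp add: d_def)
  qed
  have sum': "summable (\<lambda>n. norm (\<kappa>' n) / \<sigma> ^ n)"
    by (rule summable_comparison_test'[OF sumd, of 0]) (use high \<sigma> in simp)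
  have "(\<Sum>n. norm (\<kappa>' n) / \<sigma> ^ n)
      = (\<Sum>n. norm (\<kappa>' (n + m)) / \<sigma> ^ (n + m)) + (\<Sum>n<m. norm (\<kappa>' n) / \<sigma> ^ n)"
    by (rule suminf_split_initial_segment[OF sum'])
  also have "\<dots> \<le> (\<Sum>n. d (n + m))"
    using low sumd sum' high by (simp add: suminf_le summable_ignore_initial_segment
       summable_iff_shift[where f="\<lambda>n. norm (\<kappa>' n) / \<sigma> ^ n"])
  finally have "(\<Sum>n. norm (\<kappa>' n) / \<sigma> ^ n) \<le> S / 2" using tail by simp
  moreover have "norm (w j) = \<rho>" for j using assms(1) by (simp add: w_def norm_mult norm_power nw)
  ultimately show ?thesis using that[of w c m \<kappa>'] nc sum' by (simp add: \<kappa>'_def)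
qed

text \<open>Each remainder of \<open>quadrature_step\<close> is fed into the next step on a larger
  circle. The remainders halve, so the weights decay geometrically. Nodes and weights are fixed
  before \<open>a\<close> and \<open>M\<close>: one quadrature serves all components of a map at all
  points at once.\<close>

lemma taylor_quadrature:
  fixes \<kappa> :: "nat \<Rightarrow> complex" and \<rho> r S :: real
  assumes "0 < \<rho>" "\<rho> < r" "0 < S"
    and summ: "summable (\<lambda>n. norm (\<kappa> n) / \<rho> ^ n)" and le: "(\<Sum>n. norm (\<kappa> n) / \<rho> ^ n) \<le> S"
  obtains w c :: "nat \<Rightarrow> nat \<Rightarrow> complex" and m :: "nat \<Rightarrow> nat"
  where "\<And>k j. w k j \<in> ball 0 r" "\<And>k. (\<Sum>j<m k. norm (c k j)) \<le> S / 2 ^ k"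
    and "\<And>a M. (\<And>n. norm (a n) * r ^ n \<le> M) \<Longrightarrow>
           (\<lambda>k. \<Sum>j<m k. c k j * (\<Sum>n. a n * w k j ^ n)) sums (\<Sum>n. \<kappa> n * a n)"
proof -
  \<comment> \<open>The radii increase strictly from \<open>\<rho>\<close> and stay below
    \<open>r\<close>, so every step has a gap between its two circles and all nodes remain in the
    disc.\<close>
  define R where "R k = r - (r - \<rho>) / 2 ^ k" for k :: nat
  have R0: "R 0 = \<rho>" by (simp add: R_def)
  have Rr: "R k < r" for k using assms by (simp add: R_def)
  have RS: "R k < R (Suc k)" for k using assms by (simp add: R_def field_simps)
  have Rpos: "0 < R k" for k
  proof (induction k)
    case 0
    show ?case using R0 assms(1) by simp
  next
    case (Suc k)
    then show ?case using RS[of k] by (rule less_trans)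
  qed
  \<comment> \<open>The clause for \<open>k = 0\<close> anchors the sequence of remainders at
    \<open>\<kappa>\<close>, since dependent choice only promises the property \<open>P\<close> at
    each stage.\<close>
  define P where "P k \<mu> \<longleftrightarrow> (k = 0 \<longrightarrow> \<mu> = \<kappa>) \<and> summable (\<lambda>n. norm (\<mu> n) / R k ^ n)
      \<and> (\<Sum>n. norm (\<mu> n) / R k ^ n) \<le> S / 2 ^ k" for k :: nat and \<mu> :: "nat \<Rightarrow> complex"
  define Q where "Q k \<mu> \<mu>' m c w \<longleftrightarrow> (\<forall>j. norm (w j) = R k) \<and> (\<Sum>j<m. norm (c j)) \<le> S / 2 ^ k
      \<and> (\<forall>l. \<mu> l = (\<Sum>j<m. c j * w j ^ l) + \<mu>' l)"
    for k m :: nat and c w \<mu> \<mu>' :: "nat \<Rightarrow> complex"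
  have "\<exists>\<mu>. \<forall>k. P k (\<mu> k) \<and> (\<exists>m c w. Q k (\<mu> k) (\<mu> (Suc k)) m c w)"
  proof (rule dependent_nat_choice)
    show "\<exists>\<mu>. P 0 \<mu>" using summ le by (auto simp: P_def R0)
    fix \<mu> k assume P: "P k \<mu>"
    have pos: "0 < S / 2 ^ k" using assms by simp
    from P have PS: "summable (\<lambda>n. norm (\<mu> n) / R k ^ n)"
      "(\<Sum>n. norm (\<mu> n) / R k ^ n) \<le> S / 2 ^ k" by (simp_all add: P_def)
    show "\<exists>\<mu>'. P (Suc k) \<mu>' \<and> (\<exists>m c w. Q k \<mu> \<mu>' m c w)"
    proof (rule quadrature_step[OF Rpos RS pos PS])
      fix w c :: "nat \<Rightarrow> complex" and m :: nat and \<mu>' :: "nat \<Rightarrow> complex"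
      assume *: "\<And>j. norm (w j) = R k" "(\<Sum>j<m. norm (c j)) \<le> S / 2 ^ k"
        "\<And>l. \<mu> l = (\<Sum>j<m. c j * w j ^ l) + \<mu>' l" "summable (\<lambda>n. norm (\<mu>' n) / R (Suc k) ^ n)"
        "(\<Sum>n. norm (\<mu>' n) / R (Suc k) ^ n) \<le> S / 2 ^ k / 2"
      have "P (Suc k) \<mu>'" using *(4,5) by (simp add: P_def mult.commute)
      moreover have "Q k \<mu> \<mu>' m c w" unfolding Q_def using *(1-3) by blast
      ultimately show ?thesis by blast
    qed
  qed
  then obtain \<mu> where P: "\<And>k. P k (\<mu> k)" and "\<forall>k. \<exists>m c w. Q k (\<mu> k) (\<mu> (Suc k)) m c w"
    by blast
  then obtain m c w where Q: "\<And>k. Q k (\<mu> k) (\<mu> (Suc k)) (m k) (c k) (w k)"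
    by metis
  show ?thesis
  proof (rule that[of w c m])
    show "w k j \<in> ball 0 r" for k j using Q[of k] Rr[of k] by (simp add: Q_def)
    show "(\<Sum>j<m k. norm (c k j)) \<le> S / 2 ^ k" for k using Q[of k] by (simp add: Q_def)
    fix a :: "nat \<Rightarrow> complex" and M :: real assume a: "\<And>n. norm (a n) * r ^ n \<le> M"
    have M0: "0 \<le> M" by (rule order_trans[OF _ a[of 0]]) simp
    have r: "0 < r" using assms by simp
    have bound: "norm (\<mu> k n * a n) \<le> M * (norm (\<mu> k n) / R k ^ n)" for k n
    proof -
      have "norm (a n) * R k ^ n \<le> norm (a n) * r ^ n"
        using Rpos[of k] Rr[of k] by (intro mult_left_mono power_mono) auto
      then have "norm (a n) * R k ^ n \<le> M" using a order_trans by blast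
      then have "norm (a n) \<le> M / R k ^ n" using Rpos[of k] by (simp add: field_simps)
      then have "norm (\<mu> k n) * norm (a n) \<le> norm (\<mu> k n) * (M / R k ^ n)"
        by (rule mult_left_mono) simp
      then show ?thesis by (simp add: norm_mult mult.commute)
    qed
    have sn: "summable (\<lambda>n. norm (\<mu> k n * a n))" for k
      by (rule summable_comparison_test'[OF summable_mult[of _ M], of "\<lambda>n. norm (\<mu> k n) / R k ^ n" 0])
        (use P[of k] bound[of k] in \<open>simp_all add: P_def\<close>)
    have sz: "summable (\<lambda>n. a n * z ^ n)" if "norm z < r" for z
    proof (rule summable_comparison_test'[where N=0])
      show "summable (\<lambda>n. M * (norm z / r) ^ n)"
        using that r by (intro summable_mult summable_geometric) auto
      fix n
      have "norm (a n) \<le> M / r ^ n" using a[of n] r by (simp add: field_simps)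
      then have "norm (a n) * norm z ^ n \<le> M / r ^ n * norm z ^ n"
        by (rule mult_right_mono) simp
      then show "norm (a n * z ^ n) \<le> M * (norm z / r) ^ n"
        by (simp add: norm_mult norm_power power_divide)
    qed
    have wk: "norm (w k j) < r" for k j using Q[of k] Rr[of k] by (simp add: Q_def)
    \<comment> \<open>\<open>L k\<close> is the \<open>k\<close>-th remainder functional at
      \<open>a\<close>. Stage \<open>k\<close> of the quadrature contributes
      \<open>L k - L (Suc k)\<close>, so the series telescopes, and the halving of the remainders
      sends \<open>L k\<close> to 0.\<close>
    define L where "L k = (\<Sum>n. \<mu> k n * a n)" for k
    have step: "(\<Sum>j<m k. c k j * (\<Sum>n. a n * w k j ^ n)) = L k - L (Suc k)" for k
    proof -
      have "(\<Sum>j<m k. c k j * (\<Sum>n. a n * w k j ^ n)) = (\<Sum>n. \<Sum>j<m k. c k j * (a n * w k j ^ n))"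
        using sz[OF wk] by (simp add: suminf_sum summable_mult suminf_mult)
      also have "\<dots> = (\<Sum>n. \<mu> k n * a n - \<mu> (Suc k) n * a n)"
        using Q[of k] by (intro arg_cong[where f=suminf] ext)
          (simp add: Q_def sum_distrib_left sum_distrib_right algebra_simps)
      also have "\<dots> = L k - L (Suc k)"
        unfolding L_def using sn by (simp add: suminf_diff summable_norm_cancel)
      finally show ?thesis .
    qed
    have Lb: "norm (L k) \<le> M * S * (1 / 2) ^ k" for k
    proof -
      have "norm (L k) \<le> (\<Sum>n. norm (\<mu> k n * a n))" unfolding L_def by (rule summable_norm[OF sn])
      also have "\<dots> \<le> (\<Sum>n. M * (norm (\<mu> k n) / R k ^ n))"
        by (rule suminf_le[OF bound sn]) (use P[of k] in \<open>simp only: P_def summable_mult\<close>)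
      also have "\<dots> = M * (\<Sum>n. norm (\<mu> k n) / R k ^ n)"
        using P[of k] by (simp only: P_def suminf_mult)
      also have "\<dots> \<le> M * (S / 2 ^ k)"
        using P[of k] M0 unfolding P_def by (intro mult_left_mono) auto
      finally show ?thesis by (simp add: power_divide)
    qed
    have "(\<lambda>k. M * S * (1 / 2) ^ k) \<longlonglongrightarrow> 0"
      by (intro tendsto_mult_right_zero LIMSEQ_realpow_zero) auto
    then have "L \<longlonglongrightarrow> 0" by (rule Lim_null_comparison[rotated]) (use Lb in simp)
    then have "(\<lambda>k. L k - L (Suc k)) sums (L 0 - 0)" by (rule telescope_sums')
    moreover have "L 0 = (\<Sum>n. \<kappa> n * a n)" using P[of 0] by (simp add: L_def P_def)
    ultimately show "(\<lambda>k. \<Sum>j<m k. c k j * (\<Sum>n. a n * w k j ^ n)) sums (\<Sum>n. \<kappa> n * a n)"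
      by (simp add: step)
  qed
qed

section \<open>Calculus in the norm of a space of maps\<close>

text \<open>Both claims follow from a primitive on the disc. The second exhibits the integral as a
  functional of the Taylor coefficients, the form to which the quadrature applies.\<close>

lemma contour_integral_linepath_derivative:
  assumes "f holomorphic_on ball 0 r" "t \<in> ball 0 r"
  shows "((\<lambda>t. contour_integral (linepath 0 t) f) has_field_derivative f t) (at t)"
    and "contour_integral (linepath 0 t) f
       = (\<Sum>n. t ^ Suc n / of_nat (Suc n) * ((deriv ^^ n) f 0 / fact n))"
proof -
  obtain P where P: "\<And>z. z \<in> ball 0 r \<Longrightarrow> (P has_field_derivative f z) (at z within ball 0 r)"
    using holomorphic_convex_primitive'[OF convex_ball open_ball assms(1)] by blast
  have P': "(P has_field_derivative f z) (at z)" if "z \<in> ball 0 r" for z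
    using P[OF that] that by (simp add: at_within_open[OF _ open_ball])
  have int: "contour_integral (linepath 0 z) f = P z - P 0" if "z \<in> ball 0 r" for z
  proof -
    have 0: "0 \<in> ball (0::complex) r" using that le_less_trans[OF norm_ge_zero, of z r] by simp
    have "path_image (linepath 0 z) \<subseteq> ball 0 r"
      using closed_segment_subset[OF 0 that convex_ball] by simp
    then have "(f has_contour_integral (P z - P 0)) (linepath 0 z)"
      using contour_integral_primitive[OF P, of "linepath 0 z"] by simp
    then show ?thesis by (rule contour_integral_unique)
  qed
  have "((\<lambda>t. P t - P 0) has_field_derivative f t) (at t)"
    using P'[OF assms(2)] by (auto intro!: derivative_eq_intros)
  then show "((\<lambda>t. contour_integral (linepath 0 t) f) has_field_derivative f t) (at t)"
    by (rule has_field_derivative_transform_within_open[OF _ open_ball assms(2)]) (simp add: int)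
  have r: "0 < r" using assms(2) le_less_trans[OF norm_ge_zero, of t r] by simp
  have holP: "P holomorphic_on ball 0 r"
    unfolding holomorphic_on_def field_differentiable_def using P by blast
  have der: "(deriv ^^ Suc n) P 0 = (deriv ^^ n) f 0" for n
    unfolding funpow_Suc_right o_def
    by (rule higher_deriv_transform_within_open[OF _ assms(1) open_ball])
      (use r holP P' in \<open>auto intro!: holomorphic_deriv DERIV_imp_deriv\<close>)
  have "(\<lambda>n. (deriv ^^ n) P 0 / fact n * (t - 0) ^ n) sums P t"
    by (rule holomorphic_power_series[OF holP assms(2)])
  then have "(\<lambda>n. (deriv ^^ Suc n) P 0 / fact (Suc n) * t ^ Suc n) sums (P t - P 0)"
    by (subst sums_Suc_iff) simp
  moreover have "(deriv ^^ Suc n) P 0 / fact (Suc n) * t ^ Suc n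
      = t ^ Suc n / of_nat (Suc n) * ((deriv ^^ n) f 0 / fact n)" for n
    unfolding der by (simp add: field_simps)
  ultimately show "contour_integral (linepath 0 t) f
       = (\<Sum>n. t ^ Suc n / of_nat (Suc n) * ((deriv ^^ n) f 0 / fact n))"
    unfolding int[OF assms(2)] by (simp only: sums_iff)
qed

lemma has_norm_derivative_diff_const:
  "has_norm_derivative N (\<lambda>z x. f z x - g x) D z \<longleftrightarrow> has_norm_derivative N f D z"
  by (simp add: has_norm_derivative_def)

text \<open>Evaluations are bounded by \<open>K\<close> uniformly in the point, so convergence in
  norm implies uniform convergence of every component, and limits in \<open>Y\<close> can be
  identified by their components.\<close>

locale evaluable_map_space = banach_map_space \<Omega> Y N
  for \<Omega> :: "(real ^ 'd) set"
    and Y :: "(real ^ 'd \<Rightarrow> complex ^ 'd) set"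
    and N :: "(real ^ 'd \<Rightarrow> complex ^ 'd) \<Rightarrow> real" +
  fixes K :: real
  assumes K_nonneg: "0 \<le> K"
    and norm_eval: "f \<in> Y \<Longrightarrow> norm (f x) \<le> K * N f"
begin

section \<open>Elementary norm estimates, limits and series in \<open>Y\<close>\<close>

lemma norm_component: "f \<in> Y \<Longrightarrow> cmod (f x $ i) \<le> K * N f"
  using Finite_Cartesian_Product.norm_nth_le norm_eval order_trans by blast

lemma uminus_mem: "f \<in> Y \<Longrightarrow> (\<lambda>x. - f x) \<in> Y"
  using scale_mem[of f "-1"] by simp

lemma norm_uminus: "f \<in> Y \<Longrightarrow> N (\<lambda>x. - f x) = N f"
  using norm_scale[of f "-1"] by simp

lemma diff_mem: "f \<in> Y \<Longrightarrow> g \<in> Y \<Longrightarrow> (\<lambda>x. f x - g x) \<in> Y"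
  using add_mem[of f "\<lambda>x. - g x"] uminus_mem by simp

lemma norm_minus_commute: "f \<in> Y \<Longrightarrow> g \<in> Y \<Longrightarrow> N (\<lambda>x. f x - g x) = N (\<lambda>x. g x - f x)"
  using norm_uminus[of "\<lambda>x. f x - g x"] diff_mem[of f g] by simp

lemma norm_zero: "N (\<lambda>x. 0) = 0"
  using norm_eq_0 zero_mem by blast

lemma norm_triangle_sub: "f \<in> Y \<Longrightarrow> g \<in> Y \<Longrightarrow> N (\<lambda>x. f x - g x) \<le> N f + N g"
  using norm_triangle[of f "\<lambda>x. - g x"] uminus_mem norm_uminus by simp

lemma norm_diff_triangle:
  "f \<in> Y \<Longrightarrow> g \<in> Y \<Longrightarrow> h \<in> Y \<Longrightarrow>
     N (\<lambda>x. f x - h x) \<le> N (\<lambda>x. f x - g x) + N (\<lambda>x. g x - h x)"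
  using norm_triangle[of "\<lambda>x. f x - g x" "\<lambda>x. g x - h x"] diff_mem by simp

lemma sum_mem_norm_le:
  assumes "\<And>k. k \<in> A \<Longrightarrow> u k \<in> Y"
  shows "(\<lambda>x. \<Sum>k\<in>A. u k x) \<in> Y \<and> N (\<lambda>x. \<Sum>k\<in>A. u k x) \<le> (\<Sum>k\<in>A. N (u k))"
  using assms
proof (induction A rule: infinite_finite_induct)
  case (insert a A)
  then show ?case
    using add_mem[of "u a" "\<lambda>x. \<Sum>k\<in>A. u k x"] norm_triangle[of "u a" "\<lambda>x. \<Sum>k\<in>A. u k x"] by force
qed (simp_all add: zero_mem norm_zero)

lemma tendsto_component:
  assumes "\<forall>\<^sub>F k in \<F>. u k \<in> Y" "l \<in> Y" "((\<lambda>k. N (\<lambda>x. u k x - l x)) \<longlongrightarrow> 0) \<F>"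
  shows "((\<lambda>k. u k x $ i) \<longlongrightarrow> l x $ i) \<F>"
proof (rule LIM_zero_cancel, rule Lim_null_comparison)
  show "((\<lambda>k. K * N (\<lambda>x. u k x - l x)) \<longlongrightarrow> 0) \<F>"
    using assms(3) by (rule tendsto_mult_right_zero)
  show "\<forall>\<^sub>F k in \<F>. norm (u k x $ i - l x $ i) \<le> K * N (\<lambda>x. u k x - l x)"
    using assms(1) by eventually_elim (use norm_component[OF diff_mem[OF _ assms(2)], of _ x i] in simp)
qed

lemma norm_tendsto_le:
  assumes "\<And>k. u k \<in> Y" "l \<in> Y" "(\<lambda>k::nat. N (\<lambda>x. u k x - l x)) \<longlonglongrightarrow> 0"
    and "g \<in> Y" "\<And>k. k \<ge> n \<Longrightarrow> N (\<lambda>x. u k x - g x) \<le> B"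
  shows "N (\<lambda>x. l x - g x) \<le> B"
proof (rule LIMSEQ_le_const)
  show "(\<lambda>k. N (\<lambda>x. u k x - l x) + B) \<longlonglongrightarrow> B"
    using tendsto_add[OF assms(3) tendsto_const[of B]] by simp
  show "\<exists>M. \<forall>k\<ge>M. N (\<lambda>x. l x - g x) \<le> N (\<lambda>x. u k x - l x) + B"
  proof (intro exI allI impI)
    fix k assume "n \<le> k"
    then show "N (\<lambda>x. l x - g x) \<le> N (\<lambda>x. u k x - l x) + B"
      using norm_diff_triangle[OF assms(2) assms(1)[of k] assms(4)] assms(5)[of k]
        norm_minus_commute[OF assms(2) assms(1)[of k]] by simp
  qed
qed

text \<open>The partial sums are Cauchy because those of \<open>b\<close> are. Completeness gives
  the limit, and continuity of evaluation identifies its components.\<close>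

lemma norm_series:
  assumes u: "\<And>k. u k \<in> Y" "\<And>k. N (u k) \<le> b k" and b: "b sums B"
  obtains y where "y \<in> Y" "N y \<le> B" "\<And>x i. (\<lambda>k. u k x $ i) sums (y x $ i)"
proof -
  define s where "s n x = (\<Sum>k<n. u k x)" for n x
  have s: "s n \<in> Y" for n using sum_mem_norm_le[of "{..<n}" u] u by (simp add: s_def[abs_def])
  have bpos: "0 \<le> b k" for k using norm_nonneg[OF u(1)] u(2) order_trans by blast
  have sb: "N (\<lambda>x. s n x - s m x) \<le> (\<Sum>k\<in>{m..<n}. b k)" if "m \<le> n" for m n
  proof -
    have "(\<lambda>x. s n x - s m x) = (\<lambda>x. \<Sum>k\<in>{m..<n}. u k x)"
      using that by (simp add: s_def sum_diff_nat_ivl[of 0 m n] atLeast0LessThan[symmetric])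
    then show ?thesis using sum_mem_norm_le[of "{m..<n}" u] u sum_mono[of "{m..<n}" "\<lambda>k. N (u k)" b]
      by (metis order_trans)
  qed
  have "\<exists>M. \<forall>m\<ge>M. \<forall>n\<ge>M. N (\<lambda>x. s m x - s n x) < e" if e: "0 < e" for e
  proof -
    obtain M where M: "\<forall>m\<ge>M. \<forall>n. norm (sum b {m..<n}) < e"
      using sums_summable[OF b] e unfolding summable_Cauchy by blast
    show ?thesis
    proof (intro exI allI impI)
      fix m n assume mn: "M \<le> m" "M \<le> n"
      show "N (\<lambda>x. s m x - s n x) < e"
        using sb[of m n] sb[of n m] M[rule_format, OF mn(1), of n] M[rule_format, OF mn(2), of m]
          norm_minus_commute[OF s s, of m n] by (cases "m \<le> n") auto
    qed
  qed
  then obtain y where y: "y \<in> Y" "(\<lambda>n. N (\<lambda>x. s n x - y x)) \<longlonglongrightarrow> 0"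
    using complete[of s] s by blast
  have "N (\<lambda>x. y x - 0) \<le> B"
  proof (rule norm_tendsto_le[OF s y zero_mem, of 0])
    fix n show "N (\<lambda>x. s n x - 0) \<le> B"
      using sb[of 0 n] sum_le_suminf[OF sums_summable[OF b], of "{..<n}"] bpos sums_unique[OF b]
      by (simp add: s_def atLeast0LessThan)
  qed
  moreover have "(\<lambda>k. u k x $ i) sums (y x $ i)" for x i
    using tendsto_component[OF always_eventually[OF allI[OF s]] y, of x i] by (simp add: s_def sums_def)
  ultimately show ?thesis using that y by simp
qed

section \<open>Taylor functionals and norm derivatives of functions with holomorphic
  components\<close>

text \<open>The nodes do not depend on \<open>x\<close> and \<open>i\<close>, so each stage of the
  quadrature is a finite combination of values of \<open>f\<close> and lies in \<open>Y\<close>,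
  with norm at most \<open>S * C / 2 ^ k\<close>. Summing the stages gives the factor 2.\<close>

lemma taylor_functional_mem:
  assumes "0 < \<rho>" "\<rho> < r" "0 < S"
    and summ: "summable (\<lambda>n. norm (\<kappa> n) / \<rho> ^ n)" and le: "(\<Sum>n. norm (\<kappa> n) / \<rho> ^ n) \<le> S"
    and f: "\<And>z. z \<in> ball 0 r \<Longrightarrow> f z \<in> Y" "\<And>z. z \<in> ball 0 r \<Longrightarrow> N (f z) \<le> C"
    and a: "\<And>x i z. z \<in> ball 0 r \<Longrightarrow> (\<lambda>n. a x i n * z ^ n) sums (f z x $ i)"
      "\<And>x i n. norm (a x i n) * r ^ n \<le> M"
  obtains y where "y \<in> Y" "N y \<le> 2 * S * C" "\<And>x i. y x $ i = (\<Sum>n. \<kappa> n * a x i n)"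
proof (rule taylor_quadrature[OF assms(1-5)])
  fix w c :: "nat \<Rightarrow> nat \<Rightarrow> complex" and m
  assume w: "\<And>k j. w k j \<in> ball 0 r" and c: "\<And>k. (\<Sum>j<m k. norm (c k j)) \<le> S / 2 ^ k"
    and L: "\<And>a M. (\<And>n. norm (a n) * r ^ n \<le> M) \<Longrightarrow>
           (\<lambda>k. \<Sum>j<m k. c k j * (\<Sum>n. a n * w k j ^ n)) sums (\<Sum>n. \<kappa> n * a n)"
  have "0 \<le> C" using norm_nonneg[OF f(1)] f(2) w order_trans by blast
  define u where "u k x = (\<Sum>j<m k. c k j *s f (w k j) x)" for k x
  have u: "u k \<in> Y" for k
    unfolding u_def[abs_def] by (rule sum_mem_norm_le[THEN conjunct1]) (use scale_mem f(1) w in blast)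
  have Nu: "N (u k) \<le> S * C * (1 / 2) ^ k" for k
  proof -
    have "N (u k) \<le> (\<Sum>j<m k. N (\<lambda>x. c k j *s f (w k j) x))"
      unfolding u_def[abs_def] by (rule sum_mem_norm_le[THEN conjunct2]) (use scale_mem f(1) w in blast)
    also have "\<dots> \<le> (\<Sum>j<m k. norm (c k j) * C)"
      using norm_scale[OF f(1)[OF w]] f(2)[OF w] by (intro sum_mono) (simp add: mult_left_mono)
    also have "\<dots> \<le> S / 2 ^ k * C"
      unfolding sum_distrib_right[symmetric] by (intro mult_right_mono c \<open>0 \<le> C\<close>)
    finally show ?thesis by (simp add: power_divide)
  qed
  have geo: "(\<lambda>k. S * C * (1 / 2) ^ k) sums (S * C * 2)"
    by (intro sums_mult) (use geometric_sums[of "1/2::real"] in simp)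
  obtain y where y: "y \<in> Y" "N y \<le> S * C * 2" "\<And>x i. (\<lambda>k. u k x $ i) sums (y x $ i)"
    using norm_series[OF u Nu geo] by blast
  have "y x $ i = (\<Sum>n. \<kappa> n * a x i n)" for x i
  proof (rule sums_unique2[OF y(3)])
    have "(\<Sum>n. a x i n * w k j ^ n) = f (w k j) x $ i" for k j
      using a(1)[OF w, where x=x and i=i] by (rule sums_unique[symmetric])
    then show "(\<lambda>k. u k x $ i) sums (\<Sum>n. \<kappa> n * a x i n)"
      using L[of "a x i" M] a(2) by (simp add: u_def sum_component)
  qed
  then show ?thesis using that[of y] y by (simp add: mult_ac)
qed

text \<open>Cauchy's inequality supplies the growth bound on the Taylor coefficients, with
  \<open>M = K * C\<close>.\<close>

lemma holomorphic_functional_mem: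
  assumes "0 < \<rho>" "\<rho> < r" "0 < S"
    and "summable (\<lambda>n. norm (\<kappa> n) / \<rho> ^ n)" "(\<Sum>n. norm (\<kappa> n) / \<rho> ^ n) \<le> S"
    and f: "\<And>z. z \<in> ball 0 r \<Longrightarrow> f z \<in> Y" "\<And>z. z \<in> ball 0 r \<Longrightarrow> N (f z) \<le> C"
    and hol: "\<And>x i. (\<lambda>z. f z x $ i) holomorphic_on ball 0 r"
  obtains y where "y \<in> Y" "N y \<le> 2 * S * C"
    "\<And>x i. y x $ i = (\<Sum>n. \<kappa> n * ((deriv ^^ n) (\<lambda>z. f z x $ i) 0 / fact n))"
proof -
  \<comment> \<open>An intermediate radius: Cauchy's inequality requires continuity on the closed
    disc, while \<open>\<rho> < s\<close> must still hold for the quadrature.\<close>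
  define s where "s = (\<rho> + r) / 2"
  have s: "0 < s" "\<rho> < s" "s < r" using assms by (auto simp: s_def)
  have sub: "cball 0 s \<subseteq> ball (0::complex) r" using s by auto
  define a where "a x i n = (deriv ^^ n) (\<lambda>z. f z x $ i) 0 / fact n" for x i n
  have a1: "(\<lambda>n. a x i n * z ^ n) sums (f z x $ i)" if "z \<in> ball 0 s" for x i z
    using holomorphic_power_series[OF hol, of z x i] that s by (simp add: a_def)
  have a2: "norm (a x i n) * s ^ n \<le> K * C" for x i n
  proof -
    have "norm ((deriv ^^ n) (\<lambda>z. f z x $ i) 0) \<le> fact n * (K * C) / s ^ n"
    proof (rule Cauchy_inequality)
      show "(\<lambda>z. f z x $ i) holomorphic_on ball 0 s"
        by (rule holomorphic_on_subset[OF hol]) (use s in auto)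
      show "continuous_on (cball 0 s) (\<lambda>z. f z x $ i)"
        by (rule holomorphic_on_imp_continuous_on, rule holomorphic_on_subset[OF hol sub])
      fix z :: complex assume "cmod (0 - z) = s"
      then have z: "z \<in> ball 0 r" using s by simp
      show "cmod (f z x $ i) \<le> K * C"
        using norm_component[OF f(1)[OF z], of x i] mult_left_mono[OF f(2)[OF z] K_nonneg]
        by (rule order_trans)
    qed (use s in simp)
    then show ?thesis using s by (simp add: a_def norm_divide field_simps)
  qed
  have f': "f z \<in> Y" "N (f z) \<le> C" if "z \<in> ball 0 s" for z using f that s by auto
  from taylor_functional_mem[OF assms(1) s(2) assms(3-5) f' a1 a2] that show ?thesis
    unfolding a_def by blast
qed

text \<open>Both the derivative and the error of the difference quotient are Taylor functionals,
  hence elements of \<open>Y\<close> with explicit bounds. The derivative selects coefficient 1,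
  whose weight \<open>1 / \<rho>\<close> with \<open>\<rho> = r / 2\<close> yields
  \<open>4 * C / r\<close>; the error is of order \<open>norm w\<close>.\<close>

lemma norm_derivative_at_0:
  assumes "0 < r"
    and f: "\<And>z. z \<in> ball 0 r \<Longrightarrow> f z \<in> Y" "\<And>z. z \<in> ball 0 r \<Longrightarrow> N (f z) \<le> C"
    and hol: "\<And>x i. (\<lambda>z. f z x $ i) holomorphic_on ball 0 r"
  shows "\<exists>D\<in>Y. has_norm_derivative N f D 0 \<and> N D \<le> 4 * C / r"
proof -
  define \<rho> where "\<rho> = r / 2"
  have \<rho>: "0 < \<rho>" "\<rho> < r" using assms by (auto simp: \<rho>_def)
  define a where "a x i n = (deriv ^^ n) (\<lambda>z. f z x $ i) 0 / fact n" for x i n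
  have a: "(\<lambda>n. a x i n * z ^ n) sums (f z x $ i)" if "z \<in> ball 0 r" for x i z
    using holomorphic_power_series[OF hol that, of x i] by (simp add: a_def)
  note mem = holomorphic_functional_mem[OF \<rho> _ _ _ f hol, folded a_def]
  define \<kappa> :: "nat \<Rightarrow> complex" where "\<kappa> n = (if n = 1 then 1 else 0)" for n
  have "(\<lambda>n. norm (\<kappa> n) / \<rho> ^ n) = (\<lambda>n. if n = 1 then 1 / \<rho> ^ n else 0)"
    by (auto simp: \<kappa>_def)
  then have sum\<kappa>: "(\<lambda>n. norm (\<kappa> n) / \<rho> ^ n) sums (1 / \<rho>)"
    using sums_single[of 1 "\<lambda>n. 1 / \<rho> ^ n"] by simp
  obtain D where D: "D \<in> Y" "N D \<le> 2 * (1 / \<rho>) * C" and Da: "\<And>x i. D x $ i = (\<Sum>n. \<kappa> n * a x i n)"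
    using mem[OF _ sums_summable[OF sum\<kappa>] eq_refl[OF sums_unique[OF sum\<kappa>, symmetric]]] \<rho>(1)
    by auto
  have D1: "D x $ i = a x i 1" for x i
  proof -
    have "(\<lambda>n. \<kappa> n * a x i n) = (\<lambda>n. if n = 1 then a x i n else 0)" by (auto simp: \<kappa>_def)
    then show ?thesis using sums_unique[OF sums_single[of 1 "a x i"]] by (simp add: Da)
  qed
  have bound: "N (\<lambda>x. (1 / (w - 0)) *s (f w x - f 0 x) - D x) \<le> 4 * C / \<rho>\<^sup>2 * norm w"
    if w: "w \<noteq> 0" "norm w < \<rho> / 2" for w
  proof -
    have wr: "w \<in> ball 0 r" using w \<rho> by auto
    \<comment> \<open>Removing the terms of order 0 and 1 and dividing by \<open>w\<close> leaves
      the powers \<open>w ^ (n - 1)\<close> for \<open>n \<ge> 2\<close>. Their weighted sum is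
      geometric with ratio \<open>q < 1 / 2\<close>, hence at most
      \<open>2 * norm w / \<rho>\<^sup>2\<close>.\<close>
    define \<kappa> where "\<kappa> n = (if n < 2 then 0 else w ^ (n - 1))" for n
    define q where "q = norm w / \<rho>"
    have q: "0 \<le> q" "q < 1 / 2" using w \<rho> by (auto simp: q_def field_simps)
    have "(\<lambda>n. norm w / \<rho>\<^sup>2 * q ^ n) sums (norm w / \<rho>\<^sup>2 * (1 / (1 - q)))"
      by (intro sums_mult geometric_sums) (use q in simp)
    moreover have "norm (\<kappa> (n + 2)) / \<rho> ^ (n + 2) = norm w / \<rho>\<^sup>2 * q ^ n" for n
      by (simp add: \<kappa>_def q_def norm_mult norm_power power2_eq_square power_divide)
    ultimately have "(\<lambda>n. norm (\<kappa> (n + 2)) / \<rho> ^ (n + 2)) sums (norm w / \<rho>\<^sup>2 * (1 / (1 - q)))"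
      by simp
    then have sum\<kappa>: "(\<lambda>n. norm (\<kappa> n) / \<rho> ^ n) sums (norm w / \<rho>\<^sup>2 * (1 / (1 - q)))"
      by (subst (asm) sums_iff_shift) (simp add: \<kappa>_def numeral_2_eq_2)
    have "1 / (1 - q) \<le> 2" using q by (simp add: field_simps)
    then have le: "norm w / \<rho>\<^sup>2 * (1 / (1 - q)) \<le> norm w / \<rho>\<^sup>2 * 2"
      by (intro mult_left_mono) auto
    have pos: "0 < norm w / \<rho>\<^sup>2 * 2" using w \<rho> by simp
    obtain y where y: "y \<in> Y" "N y \<le> 2 * (norm w / \<rho>\<^sup>2 * 2) * C"
      and ya: "\<And>x i. y x $ i = (\<Sum>n. \<kappa> n * a x i n)"
      using mem[OF pos sums_summable[OF sum\<kappa>] le[unfolded sums_unique[OF sum\<kappa>]]] by blast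
    have "(1 / (w - 0)) *s (f w x - f 0 x) - D x = y x" for x
    proof (subst vec_eq_iff, rule allI)
      fix i
      have f0: "f 0 x $ i = a x i 0" by (simp add: a_def)
      have "(\<lambda>n. a x i (n + 2) * w ^ (n + 2)) sums (f w x $ i - a x i 0 - a x i 1 * w)"
        using a[OF wr, of x i] by (subst sums_iff_shift) (simp add: numeral_2_eq_2)
      then have "(\<lambda>n. 1 / w * (a x i (n + 2) * w ^ (n + 2)))
          sums (1 / w * (f w x $ i - a x i 0 - a x i 1 * w))"
        by (rule sums_mult)
      moreover have "1 / w * (a x i (n + 2) * w ^ (n + 2)) = \<kappa> (n + 2) * a x i (n + 2)" for n
        using w by (simp add: \<kappa>_def)
      ultimately have "(\<lambda>n. \<kappa> (n + 2) * a x i (n + 2))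
          sums (1 / w * (f w x $ i - a x i 0 - a x i 1 * w))" by simp
      then have "(\<lambda>n. \<kappa> n * a x i n) sums (1 / w * (f w x $ i - a x i 0 - a x i 1 * w))"
        by (subst (asm) sums_iff_shift) (simp add: \<kappa>_def numeral_2_eq_2)
      then have "y x $ i = 1 / w * (f w x $ i - a x i 0 - a x i 1 * w)"
        by (simp add: ya sums_iff)
      then show "((1 / (w - 0)) *s (f w x - f 0 x) - D x) $ i = y x $ i"
        using w by (simp add: D1 f0 field_simps)
    qed
    then have "(\<lambda>x. (1 / (w - 0)) *s (f w x - f 0 x) - D x) = y" by blast
    then show ?thesis using y(2) by (simp add: mult_ac)
  qed
  have fw: "(\<lambda>x. (1 / (w - 0)) *s (f w x - f 0 x) - D x) \<in> Y" if "norm w < \<rho> / 2" for w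
    using that \<rho> assms(1) by (intro diff_mem scale_mem f D) auto
  have "has_norm_derivative N f D 0"
    unfolding has_norm_derivative_def
  proof (rule Lim_null_comparison)
    show "((\<lambda>w::complex. 4 * C / \<rho>\<^sup>2 * norm w) \<longlongrightarrow> 0) (at 0)"
      by (intro tendsto_mult_right_zero tendsto_norm_zero tendsto_ident_at)
    show "\<forall>\<^sub>F w in at 0. norm (N (\<lambda>x. (1 / (w - 0)) *s (f w x - f 0 x) - D x)) \<le> 4 * C / \<rho>\<^sup>2 * norm w"
      unfolding eventually_at
      by (rule exI[of _ "\<rho> / 2"]) (use bound fw norm_nonneg \<rho> in \<open>auto simp: abs_of_nonneg\<close>)
  qed
  with D show ?thesis by (auto simp: \<rho>_def)
qed

lemma norm_derivative_of_pointwise_holomorphic: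
  assumes "0 < r"
    and f: "\<And>z. z \<in> ball z0 r \<Longrightarrow> f z \<in> Y" "\<And>z. z \<in> ball z0 r \<Longrightarrow> N (f z) \<le> C"
    and hol: "\<And>x i. (\<lambda>z. f z x $ i) holomorphic_on ball z0 r"
  shows "\<exists>D\<in>Y. has_norm_derivative N f D z0 \<and> N D \<le> 4 * C / r"
proof -
  have sh: "z0 + z \<in> ball z0 r" if "z \<in> ball 0 r" for z using that by (simp add: dist_norm)
  have "\<exists>D\<in>Y. has_norm_derivative N (\<lambda>z. f (z0 + z)) D 0 \<and> N D \<le> 4 * C / r"
  proof (rule norm_derivative_at_0[OF assms(1)])
    show "(\<lambda>z. f (z0 + z) x $ i) holomorphic_on ball 0 r" for x i
      by (rule holomorphic_on_compose_gen[OF _ hol, unfolded o_def]) (auto intro!: holomorphic_intros sh)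
  qed (use f sh in auto)
  moreover have "has_norm_derivative N f D z0" if "has_norm_derivative N (\<lambda>z. f (z0 + z)) D 0" for D
    using that unfolding has_norm_derivative_def by (subst LIM_offset_zero_iff) auto
  ultimately show ?thesis by blast
qed

section \<open>Mean value inequality and primitives in the norm\<close>

lemma has_norm_derivative_component:
  assumes "has_norm_derivative N f D z" "D \<in> Y" "f z \<in> Y" "\<forall>\<^sub>F w in at z. f w \<in> Y"
  shows "((\<lambda>w. f w x $ i) has_field_derivative D x $ i) (at z)"
proof -
  have "((\<lambda>w. ((1 / (w - z)) *s (f w x - f z x)) $ i) \<longlongrightarrow> D x $ i) (at z)"
  proof (rule tendsto_component)
    show "\<forall>\<^sub>F w in at z. (\<lambda>x. (1 / (w - z)) *s (f w x - f z x)) \<in> Y"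
      using assms(4) by eventually_elim (intro scale_mem diff_mem assms(3))
  qed (use assms in \<open>simp_all add: has_norm_derivative_def\<close>)
  then show ?thesis by (simp add: has_field_derivative_iff diff_divide_distrib)
qed

lemma eventually_mem_ball:
  assumes "\<And>z. z \<in> ball z0 r \<Longrightarrow> f z \<in> Y" "z \<in> ball z0 r"
  shows "\<forall>\<^sub>F w in at z. f w \<in> Y"
  using eventually_at_in_open'[OF open_ball assms(2)] by eventually_elim (rule assms(1))

text \<open>With a slack \<open>\<eta>\<close> in the slope, the estimate holds near each point by
  differentiability, and estimates on adjacent subintervals add up by the triangle inequality.
  Bisection extends it to the whole segment; then \<open>\<eta>\<close> tends to 0.\<close>

lemma norm_mean_value:
  assumes G: "\<And>z. z \<in> closed_segment a b \<Longrightarrow> G z \<in> Y"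
    and D: "\<And>z. z \<in> closed_segment a b \<Longrightarrow> D z \<in> Y" "\<And>z. z \<in> closed_segment a b \<Longrightarrow> N (D z) \<le> c"
      "\<And>z. z \<in> closed_segment a b \<Longrightarrow> has_norm_derivative N G (D z) z"
  shows "N (\<lambda>x. G b x - G a x) \<le> c * norm (b - a)"
proof -
  define \<gamma> where "\<gamma> = linepath a b"
  have \<gamma>: "\<gamma> u \<in> closed_segment a b" if "0 \<le> u" "u \<le> 1" for u
    using that unfolding \<gamma>_def by (intro linepath_in_path) auto
  have \<gamma>_diff: "norm (\<gamma> v - \<gamma> u) = \<bar>v - u\<bar> * norm (b - a)" for u v
  proof -
    have "\<gamma> v - \<gamma> u = of_real (v - u) * (b - a)"
      by (simp add: \<gamma>_def linepath_def scaleR_conv_of_real algebra_simps)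
    then show ?thesis by (simp only: norm_mult norm_of_real)
  qed
  have *: "N (\<lambda>x. G b x - G a x) \<le> (c + \<eta>) * norm (b - a)" if \<eta>: "0 < \<eta>" for \<eta>
  proof -
    have near: "\<exists>d>0. \<forall>w\<in>closed_segment a b. norm (w - z) < d \<longrightarrow> N (\<lambda>x. G w x - G z x) \<le> (c + \<eta>) * norm (w - z)"
      if z: "z \<in> closed_segment a b" for z
    proof -
      let ?q = "\<lambda>w x. (1 / (w - z)) *s (G w x - G z x)"
      obtain d where "0 < d" and d': "\<forall>w\<in>UNIV. w \<noteq> z \<and> dist w z < d \<longrightarrow> dist (N (\<lambda>x. ?q w x - D z x)) 0 < \<eta>"
        using tendstoD[OF D(3)[OF z, unfolded has_norm_derivative_def] \<eta>]
        unfolding eventually_at by blast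
      have d: "N (\<lambda>x. ?q w x - D z x) < \<eta>" if "w \<noteq> z" "norm (w - z) < d" for w
        using d'[rule_format, OF UNIV_I conjI[OF that(1) that(2)[folded dist_norm]]]
        unfolding dist_real_def by linarith
      show ?thesis
      proof (intro exI conjI ballI impI)
        fix w assume w: "w \<in> closed_segment a b" "norm (w - z) < d"
        show "N (\<lambda>x. G w x - G z x) \<le> (c + \<eta>) * norm (w - z)"
        proof (cases "w = z")
          case False
          have q: "?q w \<in> Y" by (intro scale_mem diff_mem G w z)
          have "N (?q w) \<le> N (\<lambda>x. ?q w x - D z x) + N (D z)"
            using norm_triangle[OF diff_mem[OF q D(1)[OF z]] D(1)[OF z]] by simp
          then have "N (?q w) \<le> c + \<eta>" using d[OF False w(2)] D(2)[OF z] by simp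
          then have "norm (w - z) * N (?q w) \<le> norm (w - z) * (c + \<eta>)"
            by (rule mult_left_mono) simp
          moreover have "N (\<lambda>x. (w - z) *s ?q w x) = norm (w - z) * N (?q w)"
            by (rule norm_scale[OF q])
          moreover have "(\<lambda>x. (w - z) *s ?q w x) = (\<lambda>x. G w x - G z x)"
            using False by (simp add: vector_smult_assoc)
          ultimately show ?thesis by (simp add: mult.commute)
        qed (simp add: norm_zero)
      qed (fact \<open>0 < d\<close>)
    qed
    \<comment> \<open>The guards keep the parameters in the unit interval: the local condition of
      \<open>Bolzano\<close> also ranges over \<open>u\<close> and \<open>v\<close> outside
      it.\<close>
    define P where "P u v \<longleftrightarrow> (0 \<le> u \<longrightarrow> v \<le> 1 \<longrightarrow> N (\<lambda>x. G (\<gamma> v) x - G (\<gamma> u) x) \<le> (c + \<eta>) * norm (b - a) * (v - u))"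
      for u v
    have join: "N (\<lambda>x. G (\<gamma> v) x - G (\<gamma> u) x) \<le> (c + \<eta>) * norm (b - a) * (v - u)"
      if "0 \<le> u" "u \<le> t" "t \<le> v" "v \<le> 1"
        "N (\<lambda>x. G (\<gamma> t) x - G (\<gamma> u) x) \<le> (c + \<eta>) * norm (b - a) * (t - u)"
        "N (\<lambda>x. G (\<gamma> v) x - G (\<gamma> t) x) \<le> (c + \<eta>) * norm (b - a) * (v - t)" for u t v
    proof -
      have "N (\<lambda>x. G (\<gamma> v) x - G (\<gamma> u) x) \<le> N (\<lambda>x. G (\<gamma> v) x - G (\<gamma> t) x) + N (\<lambda>x. G (\<gamma> t) x - G (\<gamma> u) x)"
        using that by (intro norm_diff_triangle G \<gamma>) auto
      with that(5,6) show ?thesis by (simp add: algebra_simps)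
    qed
    have "P 0 1"
    proof (rule Bolzano)
      show "P u v" if "P u t" "P t v" "u \<le> t" "t \<le> v" for u t v
        using that unfolding P_def using join[of u t v] by auto
      fix t :: real assume "0 \<le> t" "t \<le> 1"
      then have t: "\<gamma> t \<in> closed_segment a b" by (intro \<gamma>)
      obtain d where d: "0 < d"
        "\<And>w. w \<in> closed_segment a b \<Longrightarrow> norm (w - \<gamma> t) < d \<Longrightarrow> N (\<lambda>x. G w x - G (\<gamma> t) x) \<le> (c + \<eta>) * norm (w - \<gamma> t)"
        using near[OF t] by blast
      \<comment> \<open>The added 1 keeps the denominator positive when
        \<open>a = b\<close>.\<close>
      define d' where "d' = d / (norm (b - a) + 1)"
      have d': "0 < d'" using d by (simp add: d'_def add_nonneg_pos)
      have small: "norm (\<gamma> s - \<gamma> t) < d" if "\<bar>s - t\<bar> < d'" for s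
      proof -
        have "\<bar>s - t\<bar> * norm (b - a) \<le> \<bar>s - t\<bar> * (norm (b - a) + 1)" by (intro mult_left_mono) auto
        also have "\<dots> < d' * (norm (b - a) + 1)"
          by (rule mult_strict_right_mono[OF that]) (simp add: add_nonneg_pos)
        also have "\<dots> = d" by (simp add: d'_def add_nonneg_pos add_nonneg_eq_0_iff)
        finally show ?thesis by (simp add: \<gamma>_diff)
      qed
      show "\<exists>d>0. \<forall>u v. u \<le> t \<and> t \<le> v \<and> v - u < d \<longrightarrow> P u v"
      proof (intro exI[of _ d'] conjI d' allI impI)
        fix u v assume uv: "u \<le> t \<and> t \<le> v \<and> v - u < d'"
        show "P u v" unfolding P_def
        proof (intro impI join[of u t v])
          assume "0 \<le> u" "v \<le> 1"
          have u: "\<gamma> u \<in> closed_segment a b" and v: "\<gamma> v \<in> closed_segment a b"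
            using uv \<open>0 \<le> u\<close> \<open>v \<le> 1\<close> by (auto intro!: \<gamma>)
          show "N (\<lambda>x. G (\<gamma> v) x - G (\<gamma> t) x) \<le> (c + \<eta>) * norm (b - a) * (v - t)"
            using d(2)[OF v small] uv by (simp add: \<gamma>_diff mult_ac)
          show "N (\<lambda>x. G (\<gamma> t) x - G (\<gamma> u) x) \<le> (c + \<eta>) * norm (b - a) * (t - u)"
            using d(2)[OF u small] uv norm_minus_commute[OF G[OF u] G[OF t]]
            by (simp add: \<gamma>_diff mult_ac abs_minus_commute)
        qed (use uv in auto)
      qed
    qed simp
    then show ?thesis by (simp add: P_def \<gamma>_def linepath_0' linepath_1')
  qed
  show ?thesis
  proof (rule field_le_epsilon)
    fix e :: real assume e: "0 < e"
    show "N (\<lambda>x. G b x - G a x) \<le> c * norm (b - a) + e"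
    proof (cases "a = b")
      case True
      then show ?thesis using e by (simp add: norm_zero)
    next
      case False
      then have "(c + e / norm (b - a)) * norm (b - a) = c * norm (b - a) + e"
        by (simp add: distrib_right)
      then show ?thesis using *[of "e / norm (b - a)"] e False by simp
    qed
  qed
qed

text \<open>The primitive is a Taylor functional at each \<open>t\<close>, which puts it in
  \<open>Y\<close> with a bound on smaller discs. It is thus bounded with holomorphic components, so
  it has a norm derivative, identified with \<open>f\<close> by components.\<close>

lemma norm_derivative_integral:
  assumes f: "\<And>z. z \<in> ball 0 r \<Longrightarrow> f z \<in> Y" "\<And>z. z \<in> ball 0 r \<Longrightarrow> N (f z) \<le> C"
    and hol: "\<And>x i. (\<lambda>z. f z x $ i) holomorphic_on ball 0 r"
    and t: "t \<in> ball 0 r"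
  defines "G \<equiv> \<lambda>t x. \<chi> i. contour_integral (linepath 0 t) (\<lambda>\<zeta>. f \<zeta> x $ i)"
  shows "G t \<in> Y" "N (G t) \<le> C * norm t" "has_norm_derivative N G (f t) t"
proof -
  have r: "0 < r" using t le_less_trans[OF norm_ge_zero, of t r] by simp
  have C: "0 \<le> C" using norm_nonneg[OF f(1)[OF t]] f(2)[OF t] by simp
  \<comment> \<open>The functional depends on \<open>w\<close>, but its weights are dominated by the
    geometric sequence \<open>s * q ^ n\<close>, so one bound serves the whole closed disc of radius
    \<open>s\<close>. It degenerates as \<open>s\<close> approaches \<open>r\<close>.\<close>
  have locbound: "\<exists>B. \<forall>w. norm w \<le> s \<longrightarrow> G w \<in> Y \<and> N (G w) \<le> B" if s: "0 < s" "s < r" for s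
  proof -
    define \<rho> where "\<rho> = (s + r) / 2"
    have \<rho>: "0 < \<rho>" "\<rho> < r" "s < \<rho>" using s by (auto simp: \<rho>_def)
    define q where "q = s / \<rho>"
    have q: "0 < q" "q < 1" using \<rho> s by (auto simp: q_def)
    show ?thesis
    proof (intro exI allI impI)
      fix w :: complex assume w: "norm w \<le> s"
      define \<kappa> where "\<kappa> n = w ^ Suc n / of_nat (Suc n)" for n
      have \<kappa>: "norm (\<kappa> n) / \<rho> ^ n \<le> s * q ^ n" for n
      proof -
        have "norm (\<kappa> n) = norm w ^ Suc n / real (Suc n)"
          unfolding \<kappa>_def norm_divide norm_power norm_of_nat ..
        also have "\<dots> \<le> norm w ^ Suc n / 1"
          by (intro divide_left_mono) auto
        also have "\<dots> \<le> s ^ Suc n" using w by (simp only: div_by_1) (intro power_mono, auto)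
        finally have "norm (\<kappa> n) / \<rho> ^ n \<le> s ^ Suc n / \<rho> ^ n"
          using \<rho> by (intro divide_right_mono) auto
        then show ?thesis by (simp add: q_def power_divide)
      qed
      have geo: "(\<lambda>n. s * q ^ n) sums (s * (1 / (1 - q)))"
        using q by (intro sums_mult geometric_sums) auto
      have sum\<kappa>: "summable (\<lambda>n. norm (\<kappa> n) / \<rho> ^ n)"
        by (rule summable_comparison_test'[OF sums_summable[OF geo], of 0]) (use \<kappa> \<rho> in simp)
      have le: "(\<Sum>n. norm (\<kappa> n) / \<rho> ^ n) \<le> s * (1 / (1 - q))"
        using suminf_le[OF \<kappa> sum\<kappa> sums_summable[OF geo]] sums_unique[OF geo] by simp
      have pos: "0 < s * (1 / (1 - q))" using q s by simp
      obtain y where y: "y \<in> Y" "N y \<le> 2 * (s * (1 / (1 - q))) * C"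
        "\<And>x i. y x $ i = (\<Sum>n. \<kappa> n * ((deriv ^^ n) (\<lambda>z. f z x $ i) 0 / fact n))"
        using holomorphic_functional_mem[OF \<rho>(1,2) pos sum\<kappa> le f hol] by blast
      have wr: "w \<in> ball 0 r" using w s by simp
      have "G w = y"
        by (rule ext, subst vec_eq_iff)
          (simp add: G_def y(3) \<kappa>_def contour_integral_linepath_derivative(2)[OF hol wr])
      then show "G w \<in> Y \<and> N (G w) \<le> 2 * (s * (1 / (1 - q))) * C" using y by simp
    qed
  qed
  have GY: "G w \<in> Y" if "w \<in> ball 0 r" for w
  proof -
    have "0 < (norm w + r) / 2" "(norm w + r) / 2 < r" "norm w \<le> (norm w + r) / 2"
      using that r by (simp_all add: add_nonneg_pos)
    then show ?thesis using locbound by blast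
  qed
  have G_comp: "((\<lambda>w. G w x $ i) has_field_derivative f w x $ i) (at w)" if "w \<in> ball 0 r" for w x i
    unfolding G_def using contour_integral_linepath_derivative(1)[OF hol that] by simp
  have der: "has_norm_derivative N G (f w) w" if w: "w \<in> ball 0 r" for w
  proof -
    \<comment> \<open>The disc of radius \<open>s - norm w\<close> around \<open>w\<close> lies in
      the closed disc of radius \<open>s\<close>, where \<open>G\<close> is bounded.\<close>
    define s where "s = (norm w + r) / 2"
    have s: "0 < s" "s < r" using w r by (auto simp: s_def add_nonneg_pos)
    obtain B where B: "\<And>v. norm v \<le> s \<Longrightarrow> G v \<in> Y \<and> N (G v) \<le> B"
      using locbound[OF s] by blast
    have sw: "0 < s - norm w" using w by (simp add: s_def)
    have ball: "norm v \<le> s" if "v \<in> ball w (s - norm w)" for v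
      using that norm_triangle_ineq[of w "v - w"] by (simp add: dist_norm Real_Vector_Spaces.norm_minus_commute)
    have "(\<lambda>z. G z x $ i) holomorphic_on ball w (s - norm w)" for x i
    proof -
      have "(\<lambda>z. G z x $ i) field_differentiable (at z within ball w (s - norm w))"
        if "z \<in> ball w (s - norm w)" for z
        using G_comp[of z x i] ball[OF that] s
        by (auto simp: field_differentiable_def intro: has_field_derivative_at_within)
      then show ?thesis by (simp add: holomorphic_on_def)
    qed
    then obtain D where D: "D \<in> Y" "has_norm_derivative N G D w"
      using norm_derivative_of_pointwise_holomorphic[OF sw, of w G B] B ball by blast
    have "D x $ i = f w x $ i" for x i
      using has_norm_derivative_component[OF D(2,1) GY[OF w] eventually_mem_ball[OF GY w]] G_comp[OF w]
      by (rule DERIV_unique)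
    then have "D = f w" by (intro ext) (simp add: vec_eq_iff)
    then show ?thesis using D by simp
  qed
  show "G t \<in> Y" "has_norm_derivative N G (f t) t" using GY der t by auto
  have seg: "closed_segment 0 t \<subseteq> ball 0 r"
    using r t by (intro closed_segment_subset) auto
  \<comment> \<open>The mean value inequality replaces the local bound by one with constant
    \<open>C\<close>, uniform up to the boundary of the disc.\<close>
  have "N (\<lambda>x. G t x - G 0 x) \<le> C * norm (t - 0)"
    by (rule norm_mean_value[where D=f]) (use seg GY f der in auto)
  moreover have "G 0 = (\<lambda>x. 0)" by (simp add: G_def vec_eq_iff fun_eq_iff)
  ultimately show "N (G t) \<le> C * norm t" by simp
qed

section \<open>Analytic families of maps near the identity\<close>

lemma analytic_Id_ball_mono:
  "X \<in> analytic_Id_ball \<Omega> Y N \<epsilon> r \<Longrightarrow> \<epsilon> \<le> \<delta> \<Longrightarrow> X \<in> analytic_Id_ball \<Omega> Y N \<delta> r"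
  unfolding analytic_Id_ball_def Id_ball_def by fastforce

lemma analytic_Id_ballD:
  assumes "X \<in> analytic_Id_ball \<Omega> Y N \<eta> r" "t \<in> ball 0 r"
  shows "X t \<in> Id_ball \<Omega> Y N \<eta>" "(\<lambda>x. X t x - Id_map \<Omega> x) \<in> Y"
    "N (\<lambda>x. X t x - Id_map \<Omega> x) \<le> \<eta>"
  using assms by (auto simp: analytic_Id_ball_def Id_ball_def)

text \<open>Membership in the ball is itself the norm bound that turns holomorphic components into
  analyticity in \<open>Y\<close>, by a derivative estimate on the disc of radius
  \<open>r - norm z\<close> around each \<open>z\<close>.\<close>

lemma analytic_Id_ballI:
  assumes X: "\<And>z. z \<in> ball 0 r \<Longrightarrow> X z \<in> Id_ball \<Omega> Y N \<eta>"
    and hol: "\<And>x i. (\<lambda>z. X z x $ i) holomorphic_on ball 0 r"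
  shows "X \<in> analytic_Id_ball \<Omega> Y N \<eta> r"
proof -
  have "\<exists>D\<in>Y. has_norm_derivative N (\<lambda>z x. X z x - Id_map \<Omega> x) D z" if z: "z \<in> ball 0 r" for z
  proof -
    have pos: "0 < r - norm z" using z by simp
    have sub: "ball z (r - norm z) \<subseteq> ball 0 r" by (simp add: ball_subset_ball_iff)
    have "\<exists>D\<in>Y. has_norm_derivative N (\<lambda>z x. X z x - Id_map \<Omega> x) D z \<and> N D \<le> 4 * \<eta> / (r - norm z)"
    proof (rule norm_derivative_of_pointwise_holomorphic[OF pos])
      show "(\<lambda>z. (X z x - Id_map \<Omega> x) $ i) holomorphic_on ball z (r - norm z)" for x i
        using holomorphic_on_subset[OF hol sub, of x i] by (auto intro!: holomorphic_intros)
    qed (use X sub in \<open>auto simp: Id_ball_def\<close>)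
    then show ?thesis by blast
  qed
  with X show ?thesis by (auto simp: analytic_Id_ball_def analytic_maps_def Id_ball_def)
qed

lemma ode_component:
  assumes "X \<in> analytic_Id_ball \<Omega> Y N \<eta> r" "z \<in> ball 0 r" "D \<in> Y" "has_norm_derivative N X D z"
  shows "((\<lambda>w. X w x $ i) has_field_derivative D x $ i) (at z)"
proof -
  have "((\<lambda>w. (X w x - Id_map \<Omega> x) $ i) has_field_derivative D x $ i) (at z)"
  proof (rule has_norm_derivative_component[where f="\<lambda>z x. X z x - Id_map \<Omega> x"])
    show "\<forall>\<^sub>F w in at z. (\<lambda>x. X w x - Id_map \<Omega> x) \<in> Y"
      by (rule eventually_mem_ball[of 0 r]) (use analytic_Id_ballD assms in blast)+
  qed (use assms analytic_Id_ballD in \<open>auto simp: has_norm_derivative_diff_const\<close>)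
  then have "((\<lambda>w. (X w x - Id_map \<Omega> x) $ i + Id_map \<Omega> x $ i) has_field_derivative D x $ i + 0) (at z)"
    by (intro derivative_intros)
  then show ?thesis by simp
qed

lemma analytic_Id_ball_holomorphic:
  assumes "X \<in> analytic_Id_ball \<Omega> Y N \<eta> r"
  shows "(\<lambda>z. X z x $ i) holomorphic_on ball 0 r"
proof -
  have "(\<lambda>z. X z x $ i) field_differentiable (at z within ball 0 r)" if z: "z \<in> ball 0 r" for z
  proof -
    have "\<exists>D\<in>Y. has_norm_derivative N X D z"
      using assms z by (simp add: analytic_Id_ball_def analytic_maps_def has_norm_derivative_diff_const)
    then obtain D where "D \<in> Y" "has_norm_derivative N X D z" by blast
    from ode_component[OF assms z this] show ?thesis
      unfolding field_differentiable_def using has_field_derivative_at_within by blast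
  qed
  then show ?thesis by (simp add: holomorphic_on_def)
qed

lemma norm_eq_0_if_le_geometric:
  assumes "f \<in> Y" "\<And>n. N f \<le> c * (1 / 2) ^ n"
  shows "f x = 0"
proof -
  have "(\<lambda>n. c * (1 / 2) ^ n) \<longlonglongrightarrow> 0"
    by (intro tendsto_mult_right_zero LIMSEQ_realpow_zero) auto
  then have "N f \<le> 0" by (rule LIMSEQ_le_const) (use assms(2) in blast)
  then have "N f = 0" using norm_nonneg[OF assms(1)] by simp
  then have "f = (\<lambda>x. 0)" using norm_eq_0[OF assms(1)] by blast
  then show ?thesis by simp
qed

end

section \<open>The fixed point\<close>

text \<open>Writing \<open>\<delta>\<close> as \<open>10 * \<epsilon>\<close> separates the ball
  where \<open>F\<close> is controlled from the smaller ball where the iteration takes place; the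
  room between them is used for Cauchy estimates.\<close>

locale analytic_vector_field = evaluable_map_space \<Omega> Y N K
  for \<Omega> :: "(real ^ 'd) set"
    and Y :: "(real ^ 'd \<Rightarrow> complex ^ 'd) set"
    and N :: "(real ^ 'd \<Rightarrow> complex ^ 'd) \<Rightarrow> real"
    and K :: real +
  fixes \<epsilon> C :: real
    and F :: "(real ^ 'd \<Rightarrow> complex ^ 'd) \<Rightarrow> (real ^ 'd \<Rightarrow> complex ^ 'd)"
  assumes \<epsilon>: "0 < \<epsilon>"
    and F_mem: "X \<in> Id_ball \<Omega> Y N (10 * \<epsilon>) \<Longrightarrow> F X \<in> Y"
    and F_bound: "X \<in> Id_ball \<Omega> Y N (10 * \<epsilon>) \<Longrightarrow> N (F X) \<le> C"
    and F_analytic: "preserves_analyticity \<Omega> Y N (10 * \<epsilon>) F"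
begin

section \<open>Holomorphy and Lipschitz continuity of the vector field\<close>

lemma C_nonneg: "0 \<le> C"
proof -
  have "Id_map \<Omega> \<in> Id_ball \<Omega> Y N (10 * \<epsilon>)" using \<epsilon> by (simp add: Id_ball_def zero_mem norm_zero)
  then show ?thesis using norm_nonneg[OF F_mem] F_bound order_trans by blast
qed

lemma vector_field_along:
  assumes "0 < r" "X \<in> analytic_Id_ball \<Omega> Y N (10 * \<epsilon>) r"
  shows "\<And>z. z \<in> ball 0 r \<Longrightarrow> F (X z) \<in> Y" "\<And>z. z \<in> ball 0 r \<Longrightarrow> N (F (X z)) \<le> C"
    "(\<lambda>z. F (X z) x $ i) holomorphic_on ball 0 r"
proof -
  show mem: "F (X z) \<in> Y" and "N (F (X z)) \<le> C" if "z \<in> ball 0 r" for z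
    using F_mem F_bound analytic_Id_ballD(1)[OF assms(2) that] by auto
  show "(\<lambda>z. F (X z) x $ i) holomorphic_on ball 0 r"
  proof (cases "x \<in> \<Omega>")
    case True
    then show ?thesis using F_analytic assms
      by (auto simp: preserves_analyticity_def vec_analytic_on_def intro: analytic_imp_holomorphic)
  next
    case False
    \<comment> \<open>Preservation of analyticity speaks of points of \<open>\<Omega>\<close>;
      elsewhere every element of \<open>Y\<close> vanishes, so the component is constantly
      0.\<close>
    show ?thesis
      by (rule holomorphic_transform[OF holomorphic_on_const[of 0]])
        (use zero_outside[OF mem False] in simp)
  qed
qed

lemma vector_field_Lipschitz:
  assumes X: "X \<in> Id_ball \<Omega> Y N \<epsilon>" and X': "X' \<in> Id_ball \<Omega> Y N \<epsilon>"
  shows "N (\<lambda>x. F X' x - F X x) \<le> C / \<epsilon> * N (\<lambda>x. X' x - X x)"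
proof -
  define V where "V x = X' x - X x" for x
  define v where "v = N V"
  have XI: "(\<lambda>x. X x - Id_map \<Omega> x) \<in> Y" "N (\<lambda>x. X x - Id_map \<Omega> x) \<le> \<epsilon>"
    and XI': "(\<lambda>x. X' x - Id_map \<Omega> x) \<in> Y" "N (\<lambda>x. X' x - Id_map \<Omega> x) \<le> \<epsilon>"
    using X X' by (auto simp: Id_ball_def)
  have V: "V \<in> Y" "v \<le> 2 * \<epsilon>"
    using diff_mem[OF XI'(1) XI(1)] norm_triangle_sub[OF XI'(1) XI(1)] XI(2) XI'(2)
    by (simp_all add: V_def[abs_def] v_def)
  have v0: "0 \<le> v" using norm_nonneg[OF V(1)] by (simp add: v_def)
  have "N (\<lambda>x. F X' x - F X x) \<le> C / \<epsilon> * v"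
  proof (cases "v = 0")
    case True
    then have "V = (\<lambda>x. 0)" using norm_eq_0[OF V(1)] by (simp add: v_def)
    then have "X' = X" by (auto simp: V_def fun_eq_iff)
    then show ?thesis using True by (simp add: norm_zero)
  next
    case False
    then have v: "0 < v" using v0 by simp
    \<comment> \<open>For \<open>norm z < R\<close> the displacement \<open>z *s V\<close> has norm
      at most \<open>9 * \<epsilon>\<close>; with the distance \<open>\<epsilon>\<close> of
      \<open>X\<close> from the identity this gives \<open>10 * \<epsilon>\<close>.\<close>
    define R where "R = 9 * \<epsilon> / v"
    define Z where "Z z x = X x + z *s V x" for z x
    \<comment> \<open>Every point of the unit segment has a disc of radius \<open>R - 1\<close>
      inside the disc of radius \<open>R\<close>. Since \<open>v \<le> 2 * \<epsilon>\<close>, this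
      radius is at least \<open>7 * \<epsilon> / v\<close>, and the constant 4 of the derivative
      bound becomes \<open>4 / 7\<close>, below 1.\<close>
    have Rv: "7 * \<epsilon> / v \<le> R - 1" using v V(2) by (simp add: R_def field_simps)
    have "0 < 7 * \<epsilon> / v" using v \<epsilon> by simp
    then have R1: "0 < R - 1" using Rv by (rule less_le_trans)
    have Z: "Z \<in> analytic_Id_ball \<Omega> Y N (10 * \<epsilon>) R"
    proof (rule analytic_Id_ballI)
      fix z :: complex assume "z \<in> ball 0 R"
      then have z: "norm z * v \<le> 9 * \<epsilon>" using v by (simp add: R_def field_simps)
      have "(\<lambda>x. Z z x - Id_map \<Omega> x) = (\<lambda>x. (X x - Id_map \<Omega> x) + z *s V x)"
        by (simp add: Z_def algebra_simps)
      then show "Z z \<in> Id_ball \<Omega> Y N (10 * \<epsilon>)"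
        using add_mem[OF XI(1) scale_mem[OF V(1), of z]] norm_triangle[OF XI(1) scale_mem[OF V(1), of z]]
          norm_scale[OF V(1), of z] XI(2) z
        by (simp add: Id_ball_def v_def)
    next
      show "(\<lambda>z. Z z x $ i) holomorphic_on ball 0 R" for x i
        by (auto simp: Z_def intro!: holomorphic_intros)
    qed
    have R: "0 < R" using R1 by simp
    note FZ = vector_field_along[OF R Z]
    have seg: "ball z (R - 1) \<subseteq> ball 0 R" "z \<in> ball 0 R" if "z \<in> closed_segment 0 (1::complex)" for z
    proof -
      have "norm z \<le> 1" using segment_bound1[OF that] by simp
      then show "ball z (R - 1) \<subseteq> ball 0 R" "z \<in> ball 0 R"
        using R1 by (auto simp: ball_subset_ball_iff)
    qed
    have "\<forall>z\<in>closed_segment 0 1. \<exists>D. D \<in> Y \<and> has_norm_derivative N (\<lambda>z. F (Z z)) D z \<and> N D \<le> 4 * C / (R - 1)"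
    proof
      fix z :: complex assume z: "z \<in> closed_segment 0 1"
      have "\<exists>D\<in>Y. has_norm_derivative N (\<lambda>z. F (Z z)) D z \<and> N D \<le> 4 * C / (R - 1)"
        by (rule norm_derivative_of_pointwise_holomorphic[OF R1])
          (use FZ(1,2) seg(1)[OF z] holomorphic_on_subset[OF FZ(3) seg(1)[OF z]] in blast)+
      then show "\<exists>D. D \<in> Y \<and> has_norm_derivative N (\<lambda>z. F (Z z)) D z \<and> N D \<le> 4 * C / (R - 1)"
        by blast
    qed
    then obtain D where D: "\<And>z. z \<in> closed_segment 0 1 \<Longrightarrow>
        D z \<in> Y \<and> has_norm_derivative N (\<lambda>z. F (Z z)) (D z) z \<and> N (D z) \<le> 4 * C / (R - 1)"
      by (metis (no_types, lifting))
    have "N (\<lambda>x. F (Z 1) x - F (Z 0) x) \<le> 4 * C / (R - 1) * norm (1 - 0 :: complex)"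
      by (rule norm_mean_value[where D=D]) (use D FZ(1) seg(2) in blast)+
    moreover have "Z 1 = X'" "Z 0 = X" by (auto simp: Z_def V_def fun_eq_iff)
    ultimately have "N (\<lambda>x. F X' x - F X x) \<le> 4 * C / (R - 1)" by simp
    also have "\<dots> \<le> 4 * C / (7 * \<epsilon> / v)"
      using Rv R1 C_nonneg v \<epsilon> by (intro divide_left_mono) auto
    also have "\<dots> = 4 / 7 * (C / \<epsilon> * v)" by simp
    also have "\<dots> \<le> 1 * (C / \<epsilon> * v)"
      using C_nonneg \<epsilon> v by (intro mult_right_mono) auto
    finally show ?thesis by simp
  qed
  then show ?thesis by (simp add: v_def V_def[abs_def])
qed

section \<open>The integral operator as a contraction\<close>

lemma Phi_properties:
  assumes "0 < r" "X \<in> analytic_Id_ball \<Omega> Y N \<epsilon> r" "t \<in> ball 0 r"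
  shows "(\<lambda>x. Phi \<Omega> F X t x - Id_map \<Omega> x) \<in> Y"
    "N (\<lambda>x. Phi \<Omega> F X t x - Id_map \<Omega> x) \<le> C * norm t"
    "has_norm_derivative N (Phi \<Omega> F X) (F (X t)) t"
proof -
  have X: "X \<in> analytic_Id_ball \<Omega> Y N (10 * \<epsilon>) r"
    using analytic_Id_ball_mono[OF assms(2)] \<epsilon> by simp
  define G where "G t x = (\<chi> i. contour_integral (linepath 0 t) (\<lambda>\<zeta>. F (X \<zeta>) x $ i))" for t x
  have G: "Phi \<Omega> F X = (\<lambda>t x. Id_map \<Omega> x + G t x)" by (simp add: Phi_def G_def fun_eq_iff)
  note int = norm_derivative_integral[OF vector_field_along[OF assms(1) X] assms(3), folded G_def]
  show "(\<lambda>x. Phi \<Omega> F X t x - Id_map \<Omega> x) \<in> Y"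
    "N (\<lambda>x. Phi \<Omega> F X t x - Id_map \<Omega> x) \<le> C * norm t"
    using int by (simp_all add: G)
  show "has_norm_derivative N (Phi \<Omega> F X) (F (X t)) t"
    using int(3) by (simp add: G has_norm_derivative_def G_def)
qed

text \<open>The difference of the images is a primitive of the difference of the vector fields,
  bounded by \<open>C / \<epsilon> * B\<close> by the Lipschitz estimate. The path is shorter than
  \<open>r\<close>, and \<open>C * r \<le> \<epsilon> / 2\<close> leaves the factor 1/2.\<close>

lemma Phi_contraction:
  assumes "0 < r" "C * r \<le> \<epsilon> / 2"
    and X: "X \<in> analytic_Id_ball \<Omega> Y N \<epsilon> r" and X': "X' \<in> analytic_Id_ball \<Omega> Y N \<epsilon> r"
    and le: "\<And>t. t \<in> ball 0 r \<Longrightarrow> N (\<lambda>x. X t x - X' t x) \<le> B"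
    and t: "t \<in> ball 0 r"
  shows "N (\<lambda>x. Phi \<Omega> F X t x - Phi \<Omega> F X' t x) \<le> B / 2"
proof -
  have X10: "X \<in> analytic_Id_ball \<Omega> Y N (10 * \<epsilon>) r" "X' \<in> analytic_Id_ball \<Omega> Y N (10 * \<epsilon>) r"
    using analytic_Id_ball_mono[OF X] analytic_Id_ball_mono[OF X'] \<epsilon> by auto
  note f = vector_field_along[OF assms(1) X10(1)] and f' = vector_field_along[OF assms(1) X10(2)]
  have B: "0 \<le> B"
  proof -
    have "(\<lambda>x. (X t x - Id_map \<Omega> x) - (X' t x - Id_map \<Omega> x)) \<in> Y"
      using X X' t by (intro diff_mem analytic_Id_ballD)
    then show ?thesis using norm_nonneg le[OF t] by fastforce
  qed
  have bound: "N (\<lambda>x. F (X z) x - F (X' z) x) \<le> C / \<epsilon> * B" if z: "z \<in> ball 0 r" for z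
  proof -
    have "N (\<lambda>x. F (X z) x - F (X' z) x) \<le> C / \<epsilon> * N (\<lambda>x. X z x - X' z x)"
      by (rule vector_field_Lipschitz) (use X X' z analytic_Id_ballD in blast)+
    also have "\<dots> \<le> C / \<epsilon> * B" using le[OF z] C_nonneg \<epsilon> by (intro mult_left_mono) auto
    finally show ?thesis .
  qed
  have "N (\<lambda>x. \<chi> i. contour_integral (linepath 0 t) (\<lambda>\<zeta>. (F (X \<zeta>) x - F (X' \<zeta>) x) $ i))
      \<le> C / \<epsilon> * B * norm t"
  proof (rule norm_derivative_integral(2)[OF _ bound _ t])
    show "(\<lambda>x. F (X z) x - F (X' z) x) \<in> Y" if "z \<in> ball 0 r" for z
      using that f f' by (intro diff_mem)
    show "(\<lambda>z. (F (X z) x - F (X' z) x) $ i) holomorphic_on ball 0 r" for x i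
      using f(3) f'(3) by (auto intro!: holomorphic_intros)
  qed
  moreover have "(\<lambda>x. \<chi> i. contour_integral (linepath 0 t) (\<lambda>\<zeta>. (F (X \<zeta>) x - F (X' \<zeta>) x) $ i))
      = (\<lambda>x. Phi \<Omega> F X t x - Phi \<Omega> F X' t x)"
  proof -
    have "closed_segment 0 t \<subseteq> ball 0 r" using assms(1) t by (intro closed_segment_subset) auto
    then have "(\<lambda>\<zeta>. F (X \<zeta>) x $ i) contour_integrable_on linepath 0 t"
      "(\<lambda>\<zeta>. F (X' \<zeta>) x $ i) contour_integrable_on linepath 0 t" for x i
      using contour_integrable_holomorphic_simple[OF f(3) open_ball]
        contour_integrable_holomorphic_simple[OF f'(3) open_ball] by auto
    then show ?thesis by (simp add: Phi_def fun_eq_iff vec_eq_iff contour_integral_diff)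
  qed
  ultimately have "N (\<lambda>x. Phi \<Omega> F X t x - Phi \<Omega> F X' t x) \<le> C / \<epsilon> * B * norm t" by simp
  also have "\<dots> = (C * norm t) * B / \<epsilon>" by simp
  also have "\<dots> \<le> (\<epsilon> / 2) * B / \<epsilon>"
  proof -
    have "C * norm t \<le> C * r" using t C_nonneg by (intro mult_left_mono) auto
    then have "C * norm t \<le> \<epsilon> / 2" using assms(2) by simp
    then show ?thesis using B \<epsilon> by (intro divide_right_mono mult_right_mono) auto
  qed
  finally show ?thesis using \<epsilon> by simp
qed

lemma Phi_maps_to:
  assumes "0 < r" "C * r \<le> \<epsilon> / 2" and X: "X \<in> analytic_Id_ball \<Omega> Y N \<epsilon> r"
  shows "Phi \<Omega> F X \<in> analytic_Id_ball \<Omega> Y N \<epsilon> r"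
proof -
  have "N (\<lambda>x. Phi \<Omega> F X t x - Id_map \<Omega> x) \<le> \<epsilon>" if t: "t \<in> ball 0 r" for t
  proof -
    have "C * norm t \<le> C * r" using t C_nonneg by (intro mult_left_mono) auto
    then show ?thesis using Phi_properties(2)[OF assms(1) X t] assms(2) \<epsilon> by simp
  qed
  moreover have "\<exists>D\<in>Y. has_norm_derivative N (Phi \<Omega> F X) D t" if t: "t \<in> ball 0 r" for t
    using Phi_properties(3)[OF assms(1) X t]
      vector_field_along(1)[OF assms(1) analytic_Id_ball_mono[OF X] t] \<epsilon> by auto
  ultimately show ?thesis
    using Phi_properties(1)[OF assms(1) X]
    by (simp add: analytic_Id_ball_def analytic_maps_def Id_ball_def has_norm_derivative_diff_const)
qed

section \<open>Fixed points and their equivalence with the differential equation\<close>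

lemma mem_diff_analytic_Id_ball:
  assumes "X \<in> analytic_Id_ball \<Omega> Y N \<epsilon> r" "X' \<in> analytic_Id_ball \<Omega> Y N \<epsilon> r" "t \<in> ball 0 r"
  shows "(\<lambda>x. X t x - X' t x) \<in> Y" "N (\<lambda>x. X t x - X' t x) \<le> 2 * \<epsilon>"
proof -
  note XI = analytic_Id_ballD(2,3)[OF assms(1,3)] and XI' = analytic_Id_ballD(2,3)[OF assms(2,3)]
  show "(\<lambda>x. X t x - X' t x) \<in> Y" using diff_mem[OF XI(1) XI'(1)] by simp
  show "N (\<lambda>x. X t x - X' t x) \<le> 2 * \<epsilon>" using norm_triangle_sub[OF XI(1) XI'(1)] XI(2) XI'(2) by simp
qed

text \<open>Two fixed points differ by at most \<open>2 * \<epsilon>\<close>, and the contraction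
  halves this repeatedly. The induction generalizes over \<open>t\<close>, because the contraction
  needs the bound on the whole disc.\<close>

lemma Phi_fixed_point_unique:
  assumes "0 < r" "C * r \<le> \<epsilon> / 2"
    and X: "X \<in> analytic_Id_ball \<Omega> Y N \<epsilon> r" "\<And>t. t \<in> ball 0 r \<Longrightarrow> Phi \<Omega> F X t = X t"
    and X': "X' \<in> analytic_Id_ball \<Omega> Y N \<epsilon> r" "\<And>t. t \<in> ball 0 r \<Longrightarrow> Phi \<Omega> F X' t = X' t"
    and t: "t \<in> ball 0 r"
  shows "X' t = X t"
proof -
  have "N (\<lambda>x. X' t x - X t x) \<le> 2 * \<epsilon> * (1 / 2) ^ n" if "t \<in> ball 0 r" for n t
    using that
  proof (induction n arbitrary: t)
    case 0
    then show ?case using mem_diff_analytic_Id_ball(2)[OF X'(1) X(1)] by simp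
  next
    case (Suc n)
    then show ?case
      using Phi_contraction[OF assms(1,2) X'(1) X(1) Suc.IH Suc.prems] X(2) X'(2) by simp
  qed
  then have "X' t x - X t x = 0" for x
    by (rule norm_eq_0_if_le_geometric[OF mem_diff_analytic_Id_ball(1)[OF X'(1) X(1) t]]) (rule t)
  then show ?thesis by (simp add: fun_eq_iff)
qed

text \<open>Picard iteration from the constant family at the identity. Completeness of
  \<open>Y\<close> gives a limit at each \<open>t\<close>; the rate is uniform in \<open>t\<close>,
  so the components of the limit are holomorphic and the family is analytic in norm.\<close>

lemma Phi_fixed_point_exists:
  assumes r: "0 < r" "C * r \<le> \<epsilon> / 2"
  obtains X where "X \<in> analytic_Id_ball \<Omega> Y N \<epsilon> r" "\<And>t. t \<in> ball 0 r \<Longrightarrow> Phi \<Omega> F X t = X t"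
proof -
  define Z where "Z n = (Phi \<Omega> F ^^ n) (\<lambda>t. Id_map \<Omega>)" for n
  have Z_Suc: "Z (Suc n) = Phi \<Omega> F (Z n)" for n by (simp add: Z_def)
  have Z: "Z n \<in> analytic_Id_ball \<Omega> Y N \<epsilon> r" for n
  proof (induction n)
    case 0
    show ?case
      by (rule analytic_Id_ballI) (use \<epsilon> in \<open>auto simp: Z_def Id_ball_def zero_mem norm_zero\<close>)
  next
    case (Suc n)
    then show ?case unfolding Z_Suc by (rule Phi_maps_to[OF r])
  qed
  have cauchy: "N (\<lambda>x. Z (n + k) t x - Z n t x) \<le> 2 * \<epsilon> * (1 / 2) ^ n" if "t \<in> ball 0 r" for n k t
    using that
  proof (induction n arbitrary: t)
    case 0
    then show ?case using mem_diff_analytic_Id_ball(2)[OF Z Z] by simp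
  next
    case (Suc n)
    then show ?case
      using Phi_contraction[OF r Z Z Suc.IH Suc.prems] by (simp add: Z_Suc)
  qed
  have lim: "\<exists>l. l \<in> Y \<and> N l \<le> \<epsilon> \<and> (\<forall>n. N (\<lambda>x. l x - (Z n t x - Id_map \<Omega> x)) \<le> 2 * \<epsilon> * (1 / 2) ^ n)"
    if t: "t \<in> ball 0 r" for t
  proof -
    define u where "u n x = Z n t x - Id_map \<Omega> x" for n x
    have u: "u n \<in> Y" "N (u n) \<le> \<epsilon>" for n
      using analytic_Id_ballD(2,3)[OF Z t] by (simp_all add: u_def[abs_def])
    have uc: "N (\<lambda>x. u m x - u n x) \<le> 2 * \<epsilon> * (1 / 2) ^ n" if "n \<le> m" for m n
      using cauchy[OF t, of n "m - n"] that by (simp add: u_def)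
    have "\<exists>M. \<forall>m\<ge>M. \<forall>n\<ge>M. N (\<lambda>x. u m x - u n x) < e" if e: "0 < e" for e
    proof -
      have "(\<lambda>n. 2 * \<epsilon> * (1 / 2) ^ n) \<longlonglongrightarrow> 0"
        by (intro tendsto_mult_right_zero LIMSEQ_realpow_zero) auto
      from order_tendstoD(2)[OF this e] obtain M where M: "\<forall>n\<ge>M. 2 * \<epsilon> * (1 / 2) ^ n < e"
        unfolding eventually_sequentially by blast
      show ?thesis
      proof (intro exI allI impI)
        fix m n assume mn: "M \<le> m" "M \<le> n"
        show "N (\<lambda>x. u m x - u n x) < e"
          using uc[of n m] uc[of m n] M mn norm_minus_commute[OF u(1) u(1), of m n]
          by (cases "n \<le> m") (auto intro: le_less_trans)
      qed
    qed
    then obtain l where l: "l \<in> Y" "(\<lambda>n. N (\<lambda>x. u n x - l x)) \<longlonglongrightarrow> 0"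
      using complete[of u] u(1) by blast
    have "N (\<lambda>x. l x - 0) \<le> \<epsilon>"
      by (rule norm_tendsto_le[OF u(1) l zero_mem]) (use u in simp)
    moreover have "N (\<lambda>x. l x - u n x) \<le> 2 * \<epsilon> * (1 / 2) ^ n" for n
      by (rule norm_tendsto_le[OF u(1) l u(1) uc])
    ultimately show ?thesis using l(1) by (auto simp: u_def)
  qed
  \<comment> \<open>Limits are chosen separately at each \<open>t\<close>; the rate recorded in the
    choice restores uniformity in \<open>t\<close>.\<close>
  define X where "X t x = (SOME l. l \<in> Y \<and> N l \<le> \<epsilon> \<and>
      (\<forall>n. N (\<lambda>x. l x - (Z n t x - Id_map \<Omega> x)) \<le> 2 * \<epsilon> * (1 / 2) ^ n)) x + Id_map \<Omega> x" for t x
  have X: "X t \<in> Id_ball \<Omega> Y N \<epsilon>" and XZ: "\<And>n. N (\<lambda>x. X t x - Z n t x) \<le> 2 * \<epsilon> * (1 / 2) ^ n"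
    if "t \<in> ball 0 r" for t
    using someI_ex[OF lim[OF that]] by (auto simp: Id_ball_def X_def algebra_simps)
  have XZY: "(\<lambda>x. X t x - Z n t x) \<in> Y" if t: "t \<in> ball 0 r" for t n
    using diff_mem[of "\<lambda>x. X t x - Id_map \<Omega> x" "\<lambda>x. Z n t x - Id_map \<Omega> x"] X[OF t]
      analytic_Id_ballD(2)[OF Z t] by (simp add: Id_ball_def)
  have X_an: "X \<in> analytic_Id_ball \<Omega> Y N \<epsilon> r"
  proof (rule analytic_Id_ballI[OF X])
    fix x i
    have "uniform_limit (ball 0 r) (\<lambda>n t. Z n t x $ i) (\<lambda>t. X t x $ i) sequentially"
    proof (rule uniform_limitI)
      fix e :: real assume e: "0 < e"
      have "(\<lambda>n. K * (2 * \<epsilon> * (1 / 2) ^ n)) \<longlonglongrightarrow> 0"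
        by (intro tendsto_mult_right_zero LIMSEQ_realpow_zero) auto
      from order_tendstoD(2)[OF this e]
      show "\<forall>\<^sub>F n in sequentially. \<forall>t\<in>ball 0 r. dist (Z n t x $ i) (X t x $ i) < e"
      proof eventually_elim
        case (elim n)
        show ?case
        proof
          fix t :: complex assume t: "t \<in> ball 0 r"
          have "cmod ((X t x - Z n t x) $ i) \<le> K * N (\<lambda>x. X t x - Z n t x)"
            by (rule norm_component[OF XZY[OF t]])
          also have "\<dots> \<le> K * (2 * \<epsilon> * (1 / 2) ^ n)"
            by (rule mult_left_mono[OF XZ[OF t] K_nonneg])
          also note elim
          finally show "dist (Z n t x $ i) (X t x $ i) < e"
            by (simp add: dist_norm Real_Vector_Spaces.norm_minus_commute)
        qed
      qed
    qed
    then show "(\<lambda>t. X t x $ i) holomorphic_on ball 0 r"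
    proof (intro holomorphic_uniform_sequence[OF open_ball analytic_Id_ball_holomorphic[OF Z]])
      fix t :: complex assume "t \<in> ball 0 r"
      then obtain d where "0 < d" "cball t d \<subseteq> ball 0 r"
        using open_ball[of "0::complex" r] unfolding open_contains_cball by blast
      then show "\<exists>d>0. cball t d \<subseteq> ball 0 r
          \<and> uniform_limit (cball t d) (\<lambda>n t. Z n t x $ i) (\<lambda>t. X t x $ i) sequentially"
        using uniform_limit_on_subset \<open>uniform_limit _ _ _ _\<close> by blast
    qed
  qed
  \<comment> \<open>Compare both sides with \<open>Z (Suc n)\<close>, the image of
    \<open>Z n\<close>: the contraction bounds one distance and the rate of convergence the other,
    each by half of \<open>2 * \<epsilon> * (1 / 2) ^ n\<close>.\<close>
  have "Phi \<Omega> F X t = X t" if t: "t \<in> ball 0 r" for t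
  proof -
    have PX: "(\<lambda>x. Phi \<Omega> F X t x - X t x) \<in> Y"
      by (rule mem_diff_analytic_Id_ball(1)[OF Phi_maps_to[OF r X_an] X_an t])
    have "N (\<lambda>x. Phi \<Omega> F X t x - X t x) \<le> 2 * \<epsilon> * (1 / 2) ^ n" for n
    proof -
      have PZ: "(\<lambda>x. Phi \<Omega> F X t x - Z (Suc n) t x) \<in> Y"
        by (rule mem_diff_analytic_Id_ball(1)[OF Phi_maps_to[OF r X_an] Z t])
      have "N (\<lambda>x. Phi \<Omega> F X t x - X t x)
          \<le> N (\<lambda>x. Phi \<Omega> F X t x - Z (Suc n) t x) + N (\<lambda>x. X t x - Z (Suc n) t x)"
        using norm_triangle_sub[OF PZ XZY[OF t, of "Suc n"]] by simp
      also have "\<dots> \<le> 2 * \<epsilon> * (1 / 2) ^ n / 2 + 2 * \<epsilon> * (1 / 2) ^ Suc n"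
        using Phi_contraction[OF r X_an Z XZ t] XZ[OF t, of "Suc n"]
        unfolding Z_Suc by (intro add_mono)
      finally show ?thesis by simp
    qed
    then have "Phi \<Omega> F X t x - X t x = 0" for x by (rule norm_eq_0_if_le_geometric[OF PX])
    then show ?thesis by (simp add: fun_eq_iff)
  qed
  with X_an show ?thesis by (rule that)
qed

text \<open>From the equation to the fixed point, the fundamental theorem of calculus is applied to
  each component; conversely, the norm derivative of \<open>Phi \<Omega> F X\<close> passes to
  \<open>X\<close>. Uniqueness of solutions thus reduces to uniqueness of fixed points.\<close>

lemma solves_ode_iff_fixed_point:
  assumes r: "0 < r" and X: "X \<in> analytic_Id_ball \<Omega> Y N \<epsilon> r"
  shows "solves_ode \<Omega> N F r X \<longleftrightarrow> (\<forall>t\<in>ball 0 r. Phi \<Omega> F X t = X t)"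
proof
  assume ode: "solves_ode \<Omega> N F r X"
  have X10: "X \<in> analytic_Id_ball \<Omega> Y N (10 * \<epsilon>) r"
    using analytic_Id_ball_mono[OF X] \<epsilon> by simp
  show "\<forall>t\<in>ball 0 r. Phi \<Omega> F X t = X t"
  proof
    fix t :: complex assume t: "t \<in> ball 0 r"
    have "closed_segment 0 t \<subseteq> ball 0 r" using r t by (intro closed_segment_subset) auto
    moreover have "((\<lambda>w. X w x $ i) has_field_derivative F (X z) x $ i) (at z within ball 0 r)"
      if z: "z \<in> ball 0 r" for x i z
      by (rule has_field_derivative_at_within, rule ode_component[OF X z vector_field_along(1)[OF r X10 z]])
        (use ode z in \<open>simp add: solves_ode_def\<close>)
    ultimately have "contour_integral (linepath 0 t) (\<lambda>\<zeta>. F (X \<zeta>) x $ i) = X t x $ i - X 0 x $ i" for x i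
      using contour_integral_unique[OF contour_integral_primitive[of "ball 0 r" "\<lambda>w. X w x $ i" _ "linepath 0 t"]]
      by simp
    then show "Phi \<Omega> F X t = X t"
      using ode by (simp add: Phi_def solves_ode_def fun_eq_iff vec_eq_iff)
  qed
next
  assume fp: "\<forall>t\<in>ball 0 r. Phi \<Omega> F X t = X t"
  have "has_norm_derivative N X (F (X t)) t" if t: "t \<in> ball 0 r" for t
  proof -
    \<comment> \<open>The fixed-point identity is known only on the disc, which is a neighbourhood
      of each of its points.\<close>
    have "\<forall>\<^sub>F w in at t. N (\<lambda>x. (1 / (w - t)) *s (Phi \<Omega> F X w x - Phi \<Omega> F X t x) - F (X t) x)
        = N (\<lambda>x. (1 / (w - t)) *s (X w x - X t x) - F (X t) x)"
      using eventually_at_in_open'[OF open_ball t] by eventually_elim (simp only: fp[rule_format] t)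
    then show ?thesis
      using Phi_properties(3)[OF r X t] unfolding has_norm_derivative_def
      by (rule Lim_transform_eventually[rotated])
  qed
  moreover have "X 0 = Id_map \<Omega>"
    using fp[rule_format, of 0] r by (simp add: Phi_def fun_eq_iff vec_eq_iff)
  ultimately show "solves_ode \<Omega> N F r X" by (simp add: solves_ode_def)
qed

end

lemma dominates_C01_evaluable:
  assumes "banach_map_space \<Omega> Y N" "dominates_C01 \<Omega> Y N"
  obtains K where "evaluable_map_space \<Omega> Y N K"
proof -
  interpret banach_map_space \<Omega> Y N by fact
  obtain C' where C': "\<forall>f\<in>Y. C01_norm \<Omega> f \<le> ennreal (C' * N f)"
    using assms(2) by (auto simp: dominates_C01_def)
  have "norm (f x) \<le> max 0 C' * N f" if f: "f \<in> Y" for f x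
  proof (cases "x \<in> \<Omega>")
    case True
    then have "ennreal (norm (f x)) \<le> (SUP x\<in>\<Omega>. ennreal (norm (f x)))" by (rule SUP_upper)
    also have "\<dots> \<le> C01_norm \<Omega> f" by (simp add: C01_norm_def)
    also have "\<dots> \<le> ennreal (C' * N f)" using C' f by blast
    also have "\<dots> \<le> ennreal (max 0 C' * N f)"
      using norm_nonneg[OF f] by (intro ennreal_leI mult_right_mono) auto
    finally show ?thesis using norm_nonneg[OF f] by (simp add: ennreal_le_iff)
  next
    case False
    then show ?thesis using zero_outside[OF f] norm_nonneg[OF f] by simp
  qed
  then have "evaluable_map_space \<Omega> Y N (max 0 C')" by unfold_locales auto
  then show ?thesis by (rule that)
qed

theorem theorem2p7:
  fixes \<Omega> :: "(real ^ 'd) set"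
    and Y :: "(real ^ 'd \<Rightarrow> complex ^ 'd) set"
    and N :: "(real ^ 'd \<Rightarrow> complex ^ 'd) \<Rightarrow> real"
    and F :: "(real ^ 'd \<Rightarrow> complex ^ 'd) \<Rightarrow> (real ^ 'd \<Rightarrow> complex ^ 'd)"
    and \<delta> C \<epsilon> :: real
  assumes "open \<Omega>"
    and "banach_map_space \<Omega> Y N"
    and "dominates_C01 \<Omega> Y N"
    and "\<delta> > 0"
    and "\<And>X. X \<in> Id_ball \<Omega> Y N \<delta> \<Longrightarrow> F X \<in> Y"
    and "\<And>X. X \<in> Id_ball \<Omega> Y N \<delta> \<Longrightarrow> N (F X) \<le> C"
    and "preserves_analyticity \<Omega> Y N \<delta> F"
    and "\<epsilon> = \<delta> / 10"
  shows "\<exists>R>0. \<forall>r1. 0 < r1 \<and> r1 < R \<longrightarrow>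
    (\<forall>X\<in>analytic_Id_ball \<Omega> Y N \<epsilon> r1. Phi \<Omega> F X \<in> analytic_Id_ball \<Omega> Y N \<epsilon> r1) \<and>
    (\<exists>X\<in>analytic_Id_ball \<Omega> Y N \<epsilon> r1.
       (\<forall>t\<in>ball 0 r1. Phi \<Omega> F X t = X t) \<and>
       (\<forall>X'\<in>analytic_Id_ball \<Omega> Y N \<epsilon> r1.
          (\<forall>t\<in>ball 0 r1. Phi \<Omega> F X' t = X' t) \<longrightarrow> (\<forall>t\<in>ball 0 r1. X' t = X t)) \<and>
       (\<forall>\<alpha>\<in>\<Omega>. (\<lambda>t. X t \<alpha>) vec_analytic_on ball 0 r1) \<and>
       solves_ode \<Omega> N F r1 X \<and>
       (\<forall>X'\<in>analytic_Id_ball \<Omega> Y N \<epsilon> r1.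
          solves_ode \<Omega> N F r1 X' \<longrightarrow> (\<forall>t\<in>ball 0 r1. X' t = X t)))"
proof -
  obtain K where "evaluable_map_space \<Omega> Y N K"
    using dominates_C01_evaluable assms(2,3) by blast
  then interpret evaluable_map_space \<Omega> Y N K .
  have \<delta>: "\<delta> = 10 * \<epsilon>" using assms(8) by simp
  interpret analytic_vector_field \<Omega> Y N K \<epsilon> C F
    using assms(4-7) unfolding \<delta> by unfold_locales auto
  \<comment> \<open>The denominator uses \<open>C + 1\<close> because \<open>C\<close> may be 0. For
    \<open>r < R\<close> it gives \<open>C * r \<le> \<epsilon> / 2\<close>, which serves both
    invariance and contraction.\<close>
  define R where "R = \<epsilon> / (2 * (C + 1))"
  have R: "0 < R" using \<epsilon> C_nonneg by (simp add: R_def)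
  show ?thesis
  proof (intro exI[of _ R] conjI[OF R] allI impI, elim conjE)
    fix r assume r: "0 < r" "r < R"
    have "C * r \<le> (C + 1) * R" using r C_nonneg by (intro mult_mono) auto
    also have "\<dots> = \<epsilon> / 2" using C_nonneg by (simp add: R_def field_simps)
    finally have Cr: "C * r \<le> \<epsilon> / 2" .
    obtain X where X: "X \<in> analytic_Id_ball \<Omega> Y N \<epsilon> r" and fp: "\<And>t. t \<in> ball 0 r \<Longrightarrow> Phi \<Omega> F X t = X t"
      using Phi_fixed_point_exists[OF r(1) Cr] by blast
    have uniq: "\<forall>t\<in>ball 0 r. X' t = X t"
      if "X' \<in> analytic_Id_ball \<Omega> Y N \<epsilon> r" "\<forall>t\<in>ball 0 r. Phi \<Omega> F X' t = X' t" for X'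
      using Phi_fixed_point_unique[OF r(1) Cr X fp that(1)] that(2) by blast
    have an: "(\<lambda>t. X t \<alpha>) vec_analytic_on ball 0 r" for \<alpha>
      using analytic_Id_ball_holomorphic[OF X] by (simp add: vec_analytic_on_def analytic_on_open)
    show "(\<forall>X\<in>analytic_Id_ball \<Omega> Y N \<epsilon> r. Phi \<Omega> F X \<in> analytic_Id_ball \<Omega> Y N \<epsilon> r) \<and>
      (\<exists>X\<in>analytic_Id_ball \<Omega> Y N \<epsilon> r.
         (\<forall>t\<in>ball 0 r. Phi \<Omega> F X t = X t) \<and>
         (\<forall>X'\<in>analytic_Id_ball \<Omega> Y N \<epsilon> r.
            (\<forall>t\<in>ball 0 r. Phi \<Omega> F X' t = X' t) \<longrightarrow> (\<forall>t\<in>ball 0 r. X' t = X t)) \<and>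
         (\<forall>\<alpha>\<in>\<Omega>. (\<lambda>t. X t \<alpha>) vec_analytic_on ball 0 r) \<and>
         solves_ode \<Omega> N F r X \<and>
         (\<forall>X'\<in>analytic_Id_ball \<Omega> Y N \<epsilon> r.
            solves_ode \<Omega> N F r X' \<longrightarrow> (\<forall>t\<in>ball 0 r. X' t = X t)))"
    proof (intro conjI ballI bexI[OF _ X] impI)
      show "Phi \<Omega> F X' \<in> analytic_Id_ball \<Omega> Y N \<epsilon> r" if "X' \<in> analytic_Id_ball \<Omega> Y N \<epsilon> r" for X'
        by (rule Phi_maps_to[OF r(1) Cr that])
      show "solves_ode \<Omega> N F r X" using solves_ode_iff_fixed_point[OF r(1) X] fp by blast
      show "X' t = X t" if "X' \<in> analytic_Id_ball \<Omega> Y N \<epsilon> r" "solves_ode \<Omega> N F r X'" "t \<in> ball 0 r" for X' t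
        using solves_ode_iff_fixed_point[OF r(1) that(1)] uniq[OF that(1)] that(2,3) by blast
      show "X' t = X t" if "X' \<in> analytic_Id_ball \<Omega> Y N \<epsilon> r"
        "\<forall>t\<in>ball 0 r. Phi \<Omega> F X' t = X' t" "t \<in> ball 0 r" for X' t
        using uniq[OF that(1,2)] that(3) by blast
    qed (rule fp an, assumption?)+
  qed
qed

end
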